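(* Let $A\in\mathbb{R}^{n\times n}$ be symmetric positive definite with spectral decomposition $A=V\Lambda V^T+V_\perp\Lambda_\perp V_\perp^T$, where $(V,V_\perp)$ is an orthogonal matrix, $V\in\mathbb{R}^{n\times r}$, $\Lambda=\mathrm{diag}(\lambda_1,\dots,\lambda_r)$, $\Lambda_\perp=\mathrm{diag}(\lambda_{r+1},\dots,\lambda_n)$, $1\le r<n$, and every diagonal entry of $\Lambda$ is at most every diagonal entry of $\Lambda_\perp$. Let $Z\in\mathbb{R}^{n\times r}$ have orthonormal columns, let $E=Z^TAZ$, and let $P_D=I-AZE^{-1}Z^T$. Let $\theta$ be the acute angle between $\mathcal{V}=\mathrm{span}(V)$ and $\mathcal{Z}=\mathrm{span}(Z)$. Then $P_DA$ has $r$ zero eigenvalues; moreover, if $\cos\theta\neq 0$, then the nonzero eigenvalues (the remaining $n-r$ eigenvalues) of $P_DA$ satisfy $$\lambda_{\min}(\Lambda_\perp)-\epsilon_D\le\lambda(P_DA)\le\lambda_{\max}(\Lambda_\perp)+\eta_D,$$ where $\eta_D=\lambda_{\max}(\Lambda_\perp)(\sin\theta+\sin^2\theta)$ and $\epsilon_D=\eta_D+\|E^{-1}\|_2\left(\|E\|_2+\lambda_{\max}(\Lambda_\perp)\right)^2\tan^2\theta$.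
   Context: For two subspaces $\mathcal{Z},\mathcal{V}\subset\mathbb{R}^n$ of the same dimension $r$ with orthonormal bases given by the columns of $Z$ and $V$, $\mathrm{dist}(\mathcal{Z},\mathcal{V})=\|ZZ^T-VV^T\|_2=\sigma_{\max}(Z^TV_\perp)\in[0,1]$, where the columns of $V_\perp$ form an orthonormal basis of $\mathcal{V}^\perp$ and $\sigma_{\max}$ is the largest singular value. The acute angle between them is $\theta=\arcsin \mathrm{dist}(\mathcal{Z},\mathcal{V})\in[0,\pi/2]$. $\lambda_{\min},\lambda_{\max}$ denote smallest and largest eigenvalues, $\lambda(\cdot)$ an eigenvalue, and $\|\cdot\|_2$ the spectral norm. Eigenvalues are counted with multiplicity. *)

theory Defs
  imports
    Complex_Main
    "HOL-Computational_Algebra.Polynomial"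
    "Jordan_Normal_Form.Gauss_Jordan_Elimination"
    "Jordan_Normal_Form.Spectral_Radius"
begin

definition sym_pos_def :: "nat \<Rightarrow> real mat \<Rightarrow> bool" where
  "sym_pos_def n A \<longleftrightarrow> A \<in> carrier_mat n n \<and> A\<^sup>T = A \<and>
     (\<forall>x \<in> carrier_vec n. x \<noteq> 0\<^sub>v n \<longrightarrow> x \<bullet> (A *\<^sub>v x) > 0)"

text \<open>The predicate \<^const>\<open>orthogonal_mat\<close> of the library does not normalise the columns,
  hence the following one.\<close>

definition orthonormal_cols :: "real mat \<Rightarrow> bool" where
  "orthonormal_cols Z \<longleftrightarrow> Z\<^sup>T * Z = 1\<^sub>m (dim_col Z)"

text \<open>The matrix \<open>(B, C)\<close> obtained by putting the columns of \<open>C\<close> after those of \<open>B\<close>.\<close>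

definition hconcat :: "'a mat \<Rightarrow> 'a mat \<Rightarrow> 'a mat" where
  "hconcat B C = mat_of_cols (dim_row B) (cols B @ cols C)"

text \<open>The operator norm induced by the Euclidean vector norm; it is only meant for matrices
  with at least one column, as otherwise there are no unit vectors.\<close>

definition spectral_norm :: "real mat \<Rightarrow> real" where
  "spectral_norm A =
     (SUP x \<in> {x \<in> carrier_vec (dim_col A). sqrt (x \<bullet> x) = 1}. sqrt ((A *\<^sub>v x) \<bullet> (A *\<^sub>v x)))"

text \<open>For real matrices with only real eigenvalues; the minimum and maximum are those of a
  finite nonempty set as soon as there is an eigenvalue.\<close>

definition lambda_min :: "real mat \<Rightarrow> real" where
  "lambda_min A = Min (spectrum A)"

definition lambda_max :: "real mat \<Rightarrow> real" where
  "lambda_max A = Max (spectrum A)"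

text \<open>The real eigenvalues with their algebraic multiplicities. All complex eigenvalues of an
  \<open>n \<times> n\<close> matrix are real iff this multiset has size \<open>n\<close>.\<close>

definition eigenvalues_mset :: "real mat \<Rightarrow> real multiset" where
  "eigenvalues_mset A = proots (char_poly A)"

text \<open>The subspaces are given by matrices whose columns are orthonormal bases of them; the
  orthogonal projections \<open>Z Z\<^sup>T\<close> and \<open>V V\<^sup>T\<close> do not depend on the choice of the bases.\<close>

definition subspace_dist :: "real mat \<Rightarrow> real mat \<Rightarrow> real" where
  "subspace_dist Z V = spectral_norm (Z * Z\<^sup>T - V * V\<^sup>T)"

definition acute_angle :: "real mat \<Rightarrow> real mat \<Rightarrow> real" where
  "acute_angle Z V = arcsin (subspace_dist Z V)"

end

theory Submission
  imports Defs
begin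

text \<open>Put \<open>S = P\<^sub>D A = A - A Z E\<^sup>-\<^sup>1 Z\<^sup>T A\<close>, a symmetric matrix with \<open>S Z = 0\<close> and \<open>0 \<le> S \<le> A\<close>,
  which gives the upper bound. As \<open>S\<close> and \<open>Z Z\<^sup>T\<close> annihilate each other,
  \<open>(x I - S) (x I - Z Z\<^sup>T) = x (x I - S - Z Z\<^sup>T)\<close>; since \<open>S + Z Z\<^sup>T\<close> is nonsingular and Sylvester's
  identity gives the characteristic polynomial of \<open>Z Z\<^sup>T\<close>, the multiplicity of \<open>0\<close> follows without
  completing \<open>Z\<close> to an orthonormal basis.

  An eigenvector \<open>x\<close> of a nonzero eigenvalue is orthogonal to \<open>Z\<close>, so \<open>|V\<^sup>T x| \<le> sin \<theta> |x|\<close>, and the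
  lower bound reduces to \<open>|Z\<^sup>T A x| \<le> tan \<theta> (\<parallel>E\<parallel> + \<lambda>\<^sub>m\<^sub>a\<^sub>x) |x|\<close>. With \<open>w = Z\<^sup>T A x\<close>, split
  \<open>|w|\<^sup>2 = x \<bullet> A Z w\<close> along \<open>V\<close> and \<open>V\<^sub>\<bottom>\<close>. Testing \<open>E\<close> on \<open>Z\<^sup>T v\<^sub>i\<close> gives \<open>\<lambda>\<^sub>i cos\<^sup>2 \<theta> \<le> \<parallel>E\<parallel>\<close>, whence
  \<open>|\<Lambda> V\<^sup>T Z w|\<^sup>2 \<le> (\<parallel>E\<parallel> / cos\<^sup>2 \<theta>) w \<bullet> E w\<close>.\<close>

section \<open>Euclidean scalar product and spectral norm\<close>

lemma scalar_prod_self_nonneg: "0 \<le> x \<bullet> (x :: real vec)"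
  by (auto simp: scalar_prod_def intro: sum_nonneg)

lemma scalar_prod_self_eq_0_iff:
  fixes x :: "real vec"
  assumes "x \<in> carrier_vec n"
  shows "x \<bullet> x = 0 \<longleftrightarrow> x = 0\<^sub>v n"
  using conjugate_square_eq_0_vec[OF assms] by simp

lemma scalar_prod_Cauchy_Schwarz:
  fixes x y :: "real vec"
  assumes "x \<in> carrier_vec n" "y \<in> carrier_vec n"
  shows "(x \<bullet> y)\<^sup>2 \<le> (x \<bullet> x) * (y \<bullet> y)"
proof -
  have x: "(y \<bullet> y) \<cdot>\<^sub>v x \<in> carrier_vec n" "(x \<bullet> y) \<cdot>\<^sub>v y \<in> carrier_vec n" using assms by auto
  have xy: "y \<bullet> x = x \<bullet> y" using comm_scalar_prod[OF assms] by simp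
  \<comment> \<open>This is the residual of projecting \<open>x\<close> onto \<open>y\<close>,
    scaled by |y|^2 so that no division by a possibly vanishing norm occurs.\<close>
  let ?u = "(y \<bullet> y) \<cdot>\<^sub>v x - (x \<bullet> y) \<cdot>\<^sub>v y"
  have "?u \<bullet> ?u = (y \<bullet> y) * ((x \<bullet> x) * (y \<bullet> y) - (x \<bullet> y)\<^sup>2)"
    using assms xy
    by (simp add: minus_scalar_prod_distrib[OF x] scalar_prod_minus_distrib[OF _ x]
        scalar_prod_minus_distrib[of _ n] minus_scalar_prod_distrib[of _ n] algebra_simps power2_eq_square)
  then have *: "0 \<le> (y \<bullet> y) * ((x \<bullet> x) * (y \<bullet> y) - (x \<bullet> y)\<^sup>2)"
    using scalar_prod_self_nonneg by metis
  show ?thesis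
  proof (cases "y \<bullet> y = 0")
    case True
    then have "y = 0\<^sub>v n" using scalar_prod_self_eq_0_iff assms by blast
    then show ?thesis using assms by simp
  next
    case False
    then have "y \<bullet> y > 0" using scalar_prod_self_nonneg[of y] by linarith
    then show ?thesis using * by (simp add: zero_le_mult_iff)
  qed
qed

lemma scalar_prod_le_norms:
  fixes x y :: "real vec"
  assumes "x \<in> carrier_vec n" "y \<in> carrier_vec n"
  shows "x \<bullet> y \<le> sqrt (x \<bullet> x) * sqrt (y \<bullet> y)"
  using scalar_prod_Cauchy_Schwarz[OF assms] by (metis real_le_rsqrt real_sqrt_mult)

lemma scalar_prod_transpose:
  fixes M :: "'a :: comm_semiring_0 mat"
  assumes "M \<in> carrier_mat n m" "x \<in> carrier_vec n" "y \<in> carrier_vec m"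
  shows "x \<bullet> (M *\<^sub>v y) = (M\<^sup>T *\<^sub>v x) \<bullet> y"
  using transpose_vec_mult_scalar[OF assms(1,3,2)] by simp

text \<open>The constant is the sum of the squared row norms, obtained from Cauchy-Schwarz row by
  row. Its value is irrelevant: it shows that the set in \<open>spectral_norm\<close> is bounded
  above, without which its supremum would bound nothing.\<close>

lemma mat_vec_bounded:
  fixes M :: "real mat"
  assumes M: "M \<in> carrier_mat n m"
  obtains K where "\<And>x. x \<in> carrier_vec m \<Longrightarrow> (M *\<^sub>v x) \<bullet> (M *\<^sub>v x) \<le> K * (x \<bullet> x)"
proof
  fix x :: "real vec" assume x: "x \<in> carrier_vec m"
  have "(M *\<^sub>v x) \<bullet> (M *\<^sub>v x) = (\<Sum>i<n. (row M i \<bullet> x)\<^sup>2)"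
    using M by (auto simp: scalar_prod_def[of "M *\<^sub>v x"] power2_eq_square atLeast0LessThan)
  also have "\<dots> \<le> (\<Sum>i<n. (row M i \<bullet> row M i) * (x \<bullet> x))"
    using M x by (intro sum_mono scalar_prod_Cauchy_Schwarz[of _ m]) auto
  finally show "(M *\<^sub>v x) \<bullet> (M *\<^sub>v x) \<le> (\<Sum>i<n. row M i \<bullet> row M i) * (x \<bullet> x)"
    by (simp add: sum_distrib_right)
qed

lemma spectral_norm_upper:
  fixes M :: "real mat"
  assumes M: "M \<in> carrier_mat n m" and x: "x \<in> carrier_vec m"
  shows "sqrt ((M *\<^sub>v x) \<bullet> (M *\<^sub>v x)) \<le> spectral_norm M * sqrt (x \<bullet> x)"
proof (cases "x = 0\<^sub>v m")
  \<comment> \<open>This case covers \<open>m = 0\<close> as well, where there are no unit vectors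
    and the scaling argument below would have nothing to scale to.\<close>
  case True
  moreover have "M *\<^sub>v 0\<^sub>v m = 0\<^sub>v n" using M by (intro eq_vecI) auto
  ultimately show ?thesis by simp
next
  case False
  define c where "c = sqrt (x \<bullet> x)"
  have c2: "c * c = x \<bullet> x" unfolding c_def using scalar_prod_self_nonneg by simp
  have "x \<bullet> x \<noteq> 0" using False scalar_prod_self_eq_0_iff[OF x] by simp
  then have c: "c > 0" unfolding c_def using scalar_prod_self_nonneg[of x] by simp
  define u where "u = (1 / c) \<cdot>\<^sub>v x"
  have u: "u \<in> carrier_vec m" using x u_def by auto
  have "x = c \<cdot>\<^sub>v u" using c x unfolding u_def by auto
  have uu: "u \<bullet> u = 1" unfolding u_def using x c \<open>x \<bullet> x \<noteq> 0\<close> by (simp add: c2)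
  obtain K where K: "\<And>x. x \<in> carrier_vec m \<Longrightarrow> (M *\<^sub>v x) \<bullet> (M *\<^sub>v x) \<le> K * (x \<bullet> x)"
    using mat_vec_bounded[OF M] by metis
  have dm: "dim_col M = m" using M by auto
  have "sqrt ((M *\<^sub>v u) \<bullet> (M *\<^sub>v u)) \<le> spectral_norm M"
    unfolding spectral_norm_def dm
  proof (rule cSUP_upper)
    show "u \<in> {x \<in> carrier_vec m. sqrt (x \<bullet> x) = 1}" using u uu by simp
    show "bdd_above ((\<lambda>x. sqrt ((M *\<^sub>v x) \<bullet> (M *\<^sub>v x))) ` {x \<in> carrier_vec m. sqrt (x \<bullet> x) = 1})"
      using K by (intro bdd_aboveI[of _ "sqrt K"]) fastforce
  qed
  moreover have "sqrt ((M *\<^sub>v x) \<bullet> (M *\<^sub>v x)) = c * sqrt ((M *\<^sub>v u) \<bullet> (M *\<^sub>v u))"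
  proof -
    have "M *\<^sub>v x = c \<cdot>\<^sub>v (M *\<^sub>v u)" unfolding \<open>x = c \<cdot>\<^sub>v u\<close> by (rule mult_mat_vec[OF M u])
    then have "(M *\<^sub>v x) \<bullet> (M *\<^sub>v x) = c * c * ((M *\<^sub>v u) \<bullet> (M *\<^sub>v u))"
      using M u by simp
    then show ?thesis using c by (simp add: real_sqrt_mult)
  qed
  ultimately show ?thesis using c unfolding c_def[symmetric] by (simp add: mult.commute)
qed

text \<open>The norm dominates the length of the image of a unit vector. Such a vector exists
  because \<open>0 < m\<close>; the supremum of the empty set would carry no information.\<close>

lemma spectral_norm_nonneg:
  assumes M: "M \<in> carrier_mat n m" and m: "0 < m"
  shows "0 \<le> spectral_norm M"
  using order.trans[OF _ spectral_norm_upper[OF M unit_vec_carrier[of m 0]]] m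
  by (simp add: scalar_prod_self_nonneg)

lemma spectral_norm_le:
  assumes M: "M \<in> carrier_mat n m" and m: "0 < m"
    and K: "\<And>x. x \<in> carrier_vec m \<Longrightarrow> x \<bullet> x = 1 \<Longrightarrow> sqrt ((M *\<^sub>v x) \<bullet> (M *\<^sub>v x)) \<le> K"
  shows "spectral_norm M \<le> K"
proof -
  have dm: "dim_col M = m" using M by auto
  have "unit_vec m 0 \<in> {x \<in> carrier_vec m. sqrt (x \<bullet> x) = (1 :: real)}" using m by simp
  then have "{x \<in> carrier_vec m. sqrt (x \<bullet> x) = (1 :: real)} \<noteq> {}" by blast
  then show ?thesis unfolding spectral_norm_def dm using K by (intro cSUP_least) auto
qed

lemma spectral_norm_upper_sq:
  assumes M: "M \<in> carrier_mat n m" and x: "x \<in> carrier_vec m"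
  shows "(M *\<^sub>v x) \<bullet> (M *\<^sub>v x) \<le> (spectral_norm M)\<^sup>2 * (x \<bullet> x)"
  using power_mono[OF spectral_norm_upper[OF assms], of 2]
  by (simp add: power_mult_distrib scalar_prod_self_nonneg)

lemma spectral_norm_quadratic_form:
  assumes M: "M \<in> carrier_mat n n" and x: "x \<in> carrier_vec n"
  shows "x \<bullet> (M *\<^sub>v x) \<le> spectral_norm M * (x \<bullet> x)"
proof -
  have "x \<bullet> (M *\<^sub>v x) \<le> sqrt (x \<bullet> x) * sqrt ((M *\<^sub>v x) \<bullet> (M *\<^sub>v x))"
    using assms by (intro scalar_prod_le_norms[of _ n]) auto
  also have "\<dots> \<le> sqrt (x \<bullet> x) * (spectral_norm M * sqrt (x \<bullet> x))"
    using spectral_norm_upper[OF assms] scalar_prod_self_nonneg by (intro mult_left_mono) auto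
  finally show ?thesis using scalar_prod_self_nonneg[of x] by (simp add: mult_ac)
qed

section \<open>Sylvester's identity, characteristic polynomials and real spectra\<close>

lemma det_Sylvester:
  fixes A B :: "'a :: field mat"
  assumes A: "A \<in> carrier_mat n m" and B: "B \<in> carrier_mat m n"
  shows "x ^ m * det (x \<cdot>\<^sub>m 1\<^sub>m n - A * B) = x ^ n * det (x \<cdot>\<^sub>m 1\<^sub>m m - B * A)"
proof -
  \<comment> \<open>Block elimination in two ways. \<open>?M * ?R\<close> and \<open>?L * ?M\<close>
    are both block upper triangular, with diagonal blocks xI - AB, I and xI, xI - BA. Since
    \<open>?R\<close> has determinant 1 and \<open>?L\<close> has determinant x^m, comparing the two
    values of \<open>det ?M\<close> gives the claim. Nothing is divided by x, so it also holds at x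
    = 0.\<close>
  let ?M = "four_block_mat (x \<cdot>\<^sub>m 1\<^sub>m n) A B (1\<^sub>m m)"
  let ?R = "four_block_mat (1\<^sub>m n) (0\<^sub>m n m) (- B) (1\<^sub>m m)"
  let ?L = "four_block_mat (1\<^sub>m n) (0\<^sub>m n m) (- B) (x \<cdot>\<^sub>m 1\<^sub>m m)"
  have c: "?M \<in> carrier_mat (n + m) (n + m)" "?R \<in> carrier_mat (n + m) (n + m)"
    "?L \<in> carrier_mat (n + m) (n + m)" using A B by auto
  have "?M * ?R = four_block_mat (x \<cdot>\<^sub>m 1\<^sub>m n * 1\<^sub>m n + A * - B) (x \<cdot>\<^sub>m 1\<^sub>m n * 0\<^sub>m n m + A * 1\<^sub>m m)
     (B * 1\<^sub>m n + 1\<^sub>m m * - B) (B * 0\<^sub>m n m + 1\<^sub>m m * 1\<^sub>m m)"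
    by (rule mult_four_block_mat) (use A B in auto)
  also have "x \<cdot>\<^sub>m 1\<^sub>m n * 1\<^sub>m n + A * - B = x \<cdot>\<^sub>m 1\<^sub>m n - A * B"
    using A B by (intro eq_matI) auto
  also have "B * 1\<^sub>m n + 1\<^sub>m m * - B = 0\<^sub>m m n" using B by (intro eq_matI) auto
  also have "B * 0\<^sub>m n m + 1\<^sub>m m * 1\<^sub>m m = 1\<^sub>m m" using B by (intro eq_matI) auto
  also have "x \<cdot>\<^sub>m 1\<^sub>m n * 0\<^sub>m n m + A * 1\<^sub>m m = A" using A by (intro eq_matI) auto
  finally have "det (?M * ?R) = det (x \<cdot>\<^sub>m 1\<^sub>m n - A * B)"
    using A B by (simp, subst det_four_block_mat_lower_left_zero[of _ n _ m]) auto
  moreover have "det ?R = 1"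
    using B by (subst det_four_block_mat_upper_right_zero[of _ n _ m]) auto
  ultimately have M: "det ?M = det (x \<cdot>\<^sub>m 1\<^sub>m n - A * B)"
    using det_mult[OF c(1,2)] by simp
  have "?L * ?M = four_block_mat (1\<^sub>m n * (x \<cdot>\<^sub>m 1\<^sub>m n) + 0\<^sub>m n m * B) (1\<^sub>m n * A + 0\<^sub>m n m * 1\<^sub>m m)
     (- B * (x \<cdot>\<^sub>m 1\<^sub>m n) + x \<cdot>\<^sub>m 1\<^sub>m m * B) (- B * A + x \<cdot>\<^sub>m 1\<^sub>m m * 1\<^sub>m m)"
    by (rule mult_four_block_mat) (use A B in auto)
  also have "1\<^sub>m n * (x \<cdot>\<^sub>m 1\<^sub>m n) + 0\<^sub>m n m * B = x \<cdot>\<^sub>m 1\<^sub>m n" using B by (intro eq_matI) auto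
  also have "- B * (x \<cdot>\<^sub>m 1\<^sub>m n) + x \<cdot>\<^sub>m 1\<^sub>m m * B = 0\<^sub>m m n"
  proof -
    have "- B * (x \<cdot>\<^sub>m 1\<^sub>m n) = - (x \<cdot>\<^sub>m B)" "x \<cdot>\<^sub>m 1\<^sub>m m * B = x \<cdot>\<^sub>m B"
      using B by (auto simp: mult_smult_distrib[of _ m n] mult_smult_assoc_mat[of _ m m])
    then show ?thesis using B by (intro eq_matI) auto
  qed
  also have "- B * A + x \<cdot>\<^sub>m 1\<^sub>m m * 1\<^sub>m m = x \<cdot>\<^sub>m 1\<^sub>m m - B * A"
    using A B by (intro eq_matI) auto
  finally have "det (?L * ?M) = x ^ n * det (x \<cdot>\<^sub>m 1\<^sub>m m - B * A)"
    using A B by (simp, subst det_four_block_mat_lower_left_zero[of _ n _ m]) (auto simp: det_smult)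
  moreover have "det ?L = x ^ m"
    using B by (subst det_four_block_mat_upper_right_zero[of _ n _ m]) (auto simp: det_smult)
  ultimately show ?thesis using M det_mult[OF c(3,1)] by simp
qed

text \<open>Induction on the degree: the fundamental theorem of algebra supplies a complex root,
  which is real by assumption, and its linear factor is split off over the reals.\<close>

lemma size_proots_eq_degree:
  fixes p :: "real poly"
  assumes "\<And>z. poly (map_poly complex_of_real p) z = 0 \<Longrightarrow> z \<in> \<real>" and "p \<noteq> 0"
  shows "size (proots p) = degree p"
  using assms
proof (induction "degree p" arbitrary: p)
  case 0
  then show ?case using size_proots_le[of p] by simp
next
  case (Suc d)
  have "degree (map_poly complex_of_real p) \<noteq> 0" using Suc.hyps(2) by simp
  then obtain z where z: "poly (map_poly complex_of_real p) z = 0"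
    using fundamental_theorem_of_algebra[of "map_poly complex_of_real p"] by (auto simp: constant_degree)
  then obtain a where a: "z = complex_of_real a" using Suc.prems(1) by (auto elim: Reals_cases)
  have "poly p a = 0" using z unfolding a by simp
  then obtain q where q: "p = [:- a, 1:] * q" by (auto simp: poly_eq_0_iff_dvd elim: dvdE)
  with Suc.prems(2) have q0: "q \<noteq> 0" by auto
  have dq: "degree p = Suc (degree q)" unfolding q using q0 by (subst degree_mult_eq) auto
  \<comment> \<open>The factorisation is carried over to the complex numbers so that the cofactor
    \<open>q\<close> inherits the assumption that all complex roots are real.\<close>
  have mp: "map_poly complex_of_real p = map_poly complex_of_real [:- a, 1:] * map_poly complex_of_real q"
    unfolding q by (simp add: poly_eq_iff coeff_map_poly coeff_mult del: mult_pCons_left)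
  have "size (proots q) = degree q"
    using Suc.hyps dq q0 Suc.prems(1) unfolding mp by (intro Suc.hyps(1)) auto
  then show ?case unfolding dq unfolding q using q0 by (subst proots_mult) auto
qed

text \<open>The argument stays within real vectors: with v = x + iy, the real and imaginary parts of
  Sv = zv express Sx and Sy in x and y, and the symmetry relation between x, Sy and Sx, y collapses
  to Im z (|x|^2 + |y|^2) = 0.\<close>

lemma symmetric_complex_eigenvalue_real:
  fixes S :: "real mat"
  assumes S: "S \<in> carrier_mat n n" and sym: "S\<^sup>T = S"
    and z: "eigenvalue (map_mat complex_of_real S) z"
  shows "z \<in> \<real>"
proof -
  obtain v where v: "v \<in> carrier_vec n" "v \<noteq> 0\<^sub>v n" and ev: "map_mat complex_of_real S *\<^sub>v v = z \<cdot>\<^sub>v v"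
    using z S unfolding eigenvalue_def eigenvector_def by auto
  define x y where "x = map_vec Re v" and "y = map_vec Im v"
  have xy: "x \<in> carrier_vec n" "y \<in> carrier_vec n" using v unfolding x_def y_def by auto
  have comp: "(\<Sum>j<n. complex_of_real (S $$ (i,j)) * v $ j) = z * v $ i" if "i < n" for i
    using arg_cong[OF ev, of "\<lambda>w. w $ i"] that S v
    by (simp add: scalar_prod_def atLeast0LessThan)
  have Sx: "S *\<^sub>v x = Re z \<cdot>\<^sub>v x - Im z \<cdot>\<^sub>v y"
  proof (rule eq_vecI)
    fix i assume "i < dim_vec (Re z \<cdot>\<^sub>v x - Im z \<cdot>\<^sub>v y)"
    then have i: "i < n" using xy by simp
    show "(S *\<^sub>v x) $ i = (Re z \<cdot>\<^sub>v x - Im z \<cdot>\<^sub>v y) $ i"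
      using arg_cong[OF comp[OF i], of Re] i S v
      by (simp add: scalar_prod_def atLeast0LessThan x_def y_def)
  qed (use S xy in auto)
  have Sy: "S *\<^sub>v y = Re z \<cdot>\<^sub>v y + Im z \<cdot>\<^sub>v x"
  proof (rule eq_vecI)
    fix i assume "i < dim_vec (Re z \<cdot>\<^sub>v y + Im z \<cdot>\<^sub>v x)"
    then have i: "i < n" using xy by simp
    show "(S *\<^sub>v y) $ i = (Re z \<cdot>\<^sub>v y + Im z \<cdot>\<^sub>v x) $ i"
      using arg_cong[OF comp[OF i], of Im] i S v
      by (simp add: scalar_prod_def atLeast0LessThan x_def y_def)
  qed (use S xy in auto)
  have "x \<bullet> (S *\<^sub>v y) = (S *\<^sub>v x) \<bullet> y"
    using scalar_prod_transpose[OF S xy] sym by simp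
  then have "Im z * (x \<bullet> x + y \<bullet> y) = 0"
    unfolding Sx Sy using xy
    by (simp add: scalar_prod_add_distrib[of _ n] minus_scalar_prod_distrib[of _ n] algebra_simps)
  moreover have "x \<bullet> x + y \<bullet> y \<noteq> 0"
  proof
    assume "x \<bullet> x + y \<bullet> y = 0"
    then have "x \<bullet> x = 0" "y \<bullet> y = 0" using scalar_prod_self_nonneg[of x] scalar_prod_self_nonneg[of y] by auto
    then have xy0: "x = 0\<^sub>v n" "y = 0\<^sub>v n" using scalar_prod_self_eq_0_iff xy by blast+
    have "v = 0\<^sub>v n"
    proof (rule eq_vecI)
      fix i assume "i < dim_vec (0\<^sub>v n :: complex vec)"
      then show "v $ i = 0\<^sub>v n $ i"
        using arg_cong[OF xy0(1), of "\<lambda>w. w $ i"] arg_cong[OF xy0(2), of "\<lambda>w. w $ i"] v(1)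
        by (simp add: x_def y_def complex_eq_iff)
    qed (use v in auto)
    then show False using v by simp
  qed
  ultimately show ?thesis by (simp add: complex_is_Real_iff)
qed

text \<open>The real roots exhaust the degree of the characteristic polynomial, so that the nonzero
  eigenvalues can later be counted by subtracting the multiplicity of 0.\<close>

lemma size_eigenvalues_mset_symmetric:
  assumes S: "S \<in> carrier_mat n n" and sym: "S\<^sup>T = S"
  shows "size (eigenvalues_mset S) = n"
proof -
  have "size (proots (char_poly S)) = degree (char_poly S)"
  proof (rule size_proots_eq_degree)
    fix z assume "poly (map_poly complex_of_real (char_poly S)) z = 0"
    then have "eigenvalue (map_mat complex_of_real S) z"
      using S by (subst eigenvalue_root_char_poly[of _ n]) (auto simp: of_real_hom.char_poly_hom[OF S])
    then show "z \<in> \<real>" by (rule symmetric_complex_eigenvalue_real[OF S sym])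
  next
    show "char_poly S \<noteq> 0" using degree_monic_char_poly[OF S] by auto
  qed
  then show ?thesis unfolding eigenvalues_mset_def using degree_monic_char_poly[OF S] by simp
qed

lemma poly_char_poly_det:
  fixes S :: "'a :: field mat"
  assumes S: "S \<in> carrier_mat n n"
  shows "poly (char_poly S) x = det (x \<cdot>\<^sub>m 1\<^sub>m n - S)"
proof -
  have "- char_matrix S x = x \<cdot>\<^sub>m 1\<^sub>m n - S"
    unfolding char_matrix_def using S by (intro eq_matI) auto
  then show ?thesis using char_poly_matrix[OF S] by simp
qed

text \<open>Write p_M for the characteristic polynomial of M and T = Z Z^T. The orders at 0 are
  compared in p_S p_T = x^n p_(S+T) and x^r p_T = x^n (x - 1)^r. The assumption \<open>ker\<close>
  makes S + T nonsingular, so the last factor of each right-hand side has order 0; hence both p_S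
  and x^r have order n minus that of p_T.\<close>

lemma order_0_char_poly:
  fixes S Z :: "real mat"
  assumes S: "S \<in> carrier_mat n n" and Z: "Z \<in> carrier_mat n r" "Z\<^sup>T * Z = 1\<^sub>m r"
    and SZ: "S * Z = 0\<^sub>m n r"
    and ker: "\<And>x. x \<in> carrier_vec n \<Longrightarrow> S *\<^sub>v x + Z *\<^sub>v (Z\<^sup>T *\<^sub>v x) = 0\<^sub>v n \<Longrightarrow> x = 0\<^sub>v n"
  shows "order 0 (char_poly S) = r"
proof -
  let ?T = "Z * Z\<^sup>T"
  have T: "?T \<in> carrier_mat n n" and ST: "S + ?T \<in> carrier_mat n n" using S Z by auto
  have STz: "S * ?T = 0\<^sub>m n n"
  proof -
    have "S * ?T = S * Z * Z\<^sup>T" using S Z by (simp add: assoc_mult_mat[of _ n n _ r _ n])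
    then show ?thesis using Z unfolding SZ by simp
  qed
  have prod: "(x \<cdot>\<^sub>m 1\<^sub>m n - S) * (x \<cdot>\<^sub>m 1\<^sub>m n - ?T) = x \<cdot>\<^sub>m (x \<cdot>\<^sub>m 1\<^sub>m n - (S + ?T))" for x
  proof -
    have "(x \<cdot>\<^sub>m 1\<^sub>m n - S) * (x \<cdot>\<^sub>m 1\<^sub>m n - ?T)
      = (x \<cdot>\<^sub>m 1\<^sub>m n - S) * (x \<cdot>\<^sub>m 1\<^sub>m n) - (x \<cdot>\<^sub>m 1\<^sub>m n - S) * ?T"
      using S by (intro mult_minus_distrib_mat[of _ n n _ n] minus_carrier_mat T) auto
    also have "(x \<cdot>\<^sub>m 1\<^sub>m n - S) * (x \<cdot>\<^sub>m 1\<^sub>m n) = x \<cdot>\<^sub>m (x \<cdot>\<^sub>m 1\<^sub>m n - S)"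
      using S by (subst mult_smult_distrib[of _ n n _ n]) auto
    also have "(x \<cdot>\<^sub>m 1\<^sub>m n - S) * ?T = x \<cdot>\<^sub>m ?T"
    proof -
      have "(x \<cdot>\<^sub>m 1\<^sub>m n - S) * ?T = (x \<cdot>\<^sub>m 1\<^sub>m n) * ?T - S * ?T"
        using S by (intro minus_mult_distrib_mat[of _ n n _ _ n] minus_carrier_mat T) auto
      also have "(x \<cdot>\<^sub>m 1\<^sub>m n) * ?T = x \<cdot>\<^sub>m ?T"
        using T by (subst mult_smult_assoc_mat[of _ n n _ n]) auto
      finally show ?thesis unfolding STz using T by (intro eq_matI) auto
    qed
    finally show ?thesis using S T Z by (auto intro!: eq_matI simp: algebra_simps)
  qed
  \<comment> \<open>Both polynomial identities are checked at every real point, where they become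
    identities between determinants of real matrices.\<close>
  have 1: "char_poly S * char_poly ?T = [:0, 1:] ^ n * char_poly (S + ?T)"
  proof (rule poly_ext)
    fix x
    have "det (x \<cdot>\<^sub>m 1\<^sub>m n - S) * det (x \<cdot>\<^sub>m 1\<^sub>m n - ?T) = det ((x \<cdot>\<^sub>m 1\<^sub>m n - S) * (x \<cdot>\<^sub>m 1\<^sub>m n - ?T))"
      using S by (intro det_mult[symmetric, of _ n] minus_carrier_mat T) auto
    also have "\<dots> = x ^ n * det (x \<cdot>\<^sub>m 1\<^sub>m n - (S + ?T))"
      unfolding prod det_smult using S Z by simp
    finally show "poly (char_poly S * char_poly ?T) x = poly ([:0, 1:] ^ n * char_poly (S + ?T)) x"
      by (simp add: poly_char_poly_det[OF S] poly_char_poly_det[OF T] poly_char_poly_det[OF ST])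
  qed
  have 2: "[:0, 1:] ^ r * char_poly ?T = [:0, 1:] ^ n * [:-1, 1:] ^ r"
  proof (rule poly_ext)
    fix x :: real
    have "x \<cdot>\<^sub>m 1\<^sub>m r - 1\<^sub>m r = (x - 1) \<cdot>\<^sub>m (1\<^sub>m r :: real mat)" by (intro eq_matI) auto
    then have "x ^ r * det (x \<cdot>\<^sub>m 1\<^sub>m n - ?T) = x ^ n * (x - 1) ^ r"
      using det_Sylvester[of Z n r "Z\<^sup>T" x] Z by (simp add: det_smult)
    then show "poly ([:0, 1:] ^ r * char_poly ?T) x = poly ([:0, 1:] ^ n * [:-1, 1:] ^ r) x"
      by (simp add: poly_char_poly_det[OF T])
  qed
  have nz: "char_poly M \<noteq> 0" if "M \<in> carrier_mat n n" for M :: "real mat"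
    using degree_monic_char_poly[OF that] by auto
  have X: "order 0 ([:0, 1:] ^ k :: real poly) = k" for k
    using order_power_n_n[of 0 k] by simp
  have "poly (char_poly (S + ?T)) 0 \<noteq> 0"
  proof
    assume "poly (char_poly (S + ?T)) 0 = 0"
    then obtain v where v: "v \<in> carrier_vec n" "v \<noteq> 0\<^sub>v n" "(S + ?T) *\<^sub>v v = 0 \<cdot>\<^sub>v v"
      using eigenvalue_root_char_poly[OF ST] Z unfolding eigenvalue_def eigenvector_def by auto
    have "(S + ?T) *\<^sub>v v = S *\<^sub>v v + Z *\<^sub>v (Z\<^sup>T *\<^sub>v v)"
      using S Z v by (subst add_mult_distrib_mat_vec[of _ n n]) (auto simp: assoc_mult_mat_vec[of _ n r _ n])
    moreover have "0 \<cdot>\<^sub>v v = 0\<^sub>v n" using v by auto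
    ultimately show False using ker[OF v(1)] v by simp
  qed
  then have ord0: "order 0 (char_poly (S + ?T)) = 0" by (rule order_0I)
  have "order 0 (char_poly S) + order 0 (char_poly ?T) = n"
    using arg_cong[OF 1, of "order 0"] nz[OF S] nz[OF T] nz[OF ST]
    by (simp add: order_mult X ord0)
  moreover have "order 0 ([:-1, 1:] ^ r :: real poly) = 0" by (rule order_0I) simp
  then have "r + order 0 (char_poly ?T) = n"
    using arg_cong[OF 2, of "order 0"] nz[OF T] by (simp add: order_mult X)
  ultimately show ?thesis by simp
qed

section \<open>Orthonormal columns and the distance of subspaces\<close>

lemma orthonormal_isometry:
  fixes Z :: "real mat"
  assumes Z: "Z \<in> carrier_mat n r" "Z\<^sup>T * Z = 1\<^sub>m r"
    and x: "x \<in> carrier_vec r" and y: "y \<in> carrier_vec r"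
  shows "(Z *\<^sub>v x) \<bullet> (Z *\<^sub>v y) = x \<bullet> y"
proof -
  have "(Z *\<^sub>v x) \<bullet> (Z *\<^sub>v y) = (Z\<^sup>T *\<^sub>v (Z *\<^sub>v x)) \<bullet> y"
    by (rule scalar_prod_transpose) (use Z x y in auto)
  also have "Z\<^sup>T *\<^sub>v (Z *\<^sub>v x) = (Z\<^sup>T * Z) *\<^sub>v x"
    using assoc_mult_mat_vec[of "Z\<^sup>T" r n Z r x] Z x by simp
  finally show ?thesis using Z x by simp
qed

lemma orthonormal_projection_residual:
  fixes Z :: "real mat"
  assumes Z: "Z \<in> carrier_mat n r" "Z\<^sup>T * Z = 1\<^sub>m r" and x: "x \<in> carrier_vec n"
  shows "(x - Z *\<^sub>v (Z\<^sup>T *\<^sub>v x)) \<bullet> (x - Z *\<^sub>v (Z\<^sup>T *\<^sub>v x)) = x \<bullet> x - (Z\<^sup>T *\<^sub>v x) \<bullet> (Z\<^sup>T *\<^sub>v x)"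
proof -
  have w: "Z\<^sup>T *\<^sub>v x \<in> carrier_vec r" "Z *\<^sub>v (Z\<^sup>T *\<^sub>v x) \<in> carrier_vec n" using Z x by auto
  have 1: "x \<bullet> (Z *\<^sub>v (Z\<^sup>T *\<^sub>v x)) = (Z\<^sup>T *\<^sub>v x) \<bullet> (Z\<^sup>T *\<^sub>v x)"
    by (rule scalar_prod_transpose[OF Z(1) x w(1)])
  have 2: "(Z *\<^sub>v (Z\<^sup>T *\<^sub>v x)) \<bullet> x = (Z\<^sup>T *\<^sub>v x) \<bullet> (Z\<^sup>T *\<^sub>v x)"
    using comm_scalar_prod[OF w(2) x] 1 by simp
  show ?thesis
    using 1 2 orthonormal_isometry[OF Z w(1) w(1)] x w
    by (simp add: minus_scalar_prod_distrib[of _ n] scalar_prod_minus_distrib[of _ n])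
qed

lemma projection_diff_mult_vec:
  fixes Z V :: "real mat"
  assumes "Z \<in> carrier_mat n r" "V \<in> carrier_mat n r" "x \<in> carrier_vec n"
  shows "(Z * Z\<^sup>T - V * V\<^sup>T) *\<^sub>v x = Z *\<^sub>v (Z\<^sup>T *\<^sub>v x) - V *\<^sub>v (V\<^sup>T *\<^sub>v x)"
  using assms by (subst minus_mult_distrib_mat_vec[of _ n n])
    (auto simp: assoc_mult_mat_vec[of _ n r _ n])

text \<open>For orthogonal projections \<open>P\<close>, \<open>Q\<close> one has
  \<open>|x|\<^sup>2 - |P x - Q x|\<^sup>2 = |x - P x - Q x|\<^sup>2\<close>.\<close>

lemma subspace_dist_le_1:
  assumes Z: "Z \<in> carrier_mat n r" "Z\<^sup>T * Z = 1\<^sub>m r"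
    and V: "V \<in> carrier_mat n r" "V\<^sup>T * V = 1\<^sub>m r" and n: "0 < n"
  shows "subspace_dist Z V \<le> 1"
  unfolding subspace_dist_def
proof (rule spectral_norm_le)
  show "Z * Z\<^sup>T - V * V\<^sup>T \<in> carrier_mat n n" using Z V by auto
  fix x :: "real vec" assume x: "x \<in> carrier_vec n" and xx: "x \<bullet> x = 1"
  define p q where "p = Z *\<^sub>v (Z\<^sup>T *\<^sub>v x)" and "q = V *\<^sub>v (V\<^sup>T *\<^sub>v x)"
  have pq: "p \<in> carrier_vec n" "q \<in> carrier_vec n" using Z V x by (auto simp: p_def q_def)
  have p: "p \<bullet> p = x \<bullet> p" unfolding p_def
    using orthonormal_isometry[OF Z, of "Z\<^sup>T *\<^sub>v x" "Z\<^sup>T *\<^sub>v x"]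
      scalar_prod_transpose[OF Z(1) x, of "Z\<^sup>T *\<^sub>v x"] Z x by auto
  have q: "q \<bullet> q = x \<bullet> q" unfolding q_def
    using orthonormal_isometry[OF V, of "V\<^sup>T *\<^sub>v x" "V\<^sup>T *\<^sub>v x"]
      scalar_prod_transpose[OF V(1) x, of "V\<^sup>T *\<^sub>v x"] V x by auto
  have "0 \<le> (x - p - q) \<bullet> (x - p - q)" by (rule scalar_prod_self_nonneg)
  also have "\<dots> = x \<bullet> x - (p - q) \<bullet> (p - q)"
    using pq x p q comm_scalar_prod[OF pq] comm_scalar_prod[OF x pq(1)] comm_scalar_prod[OF x pq(2)]
    by (simp add: minus_scalar_prod_distrib[of _ n] scalar_prod_minus_distrib[of _ n])
  finally have "(p - q) \<bullet> (p - q) \<le> 1" using xx by simp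
  then show "sqrt (((Z * Z\<^sup>T - V * V\<^sup>T) *\<^sub>v x) \<bullet> ((Z * Z\<^sup>T - V * V\<^sup>T) *\<^sub>v x)) \<le> 1"
    using projection_diff_mult_vec[OF Z(1) V(1) x] unfolding p_def q_def by simp
qed (use n in simp)

lemma subspace_dist_nonneg:
  assumes "Z \<in> carrier_mat n r" "V \<in> carrier_mat n r" "0 < n"
  shows "0 \<le> subspace_dist Z V"
  unfolding subspace_dist_def by (rule spectral_norm_nonneg[of _ n n]) (use assms in auto)

text \<open>The estimates below are instances of this inequality, for vectors orthogonal to the
  range of \<open>Z\<close> and for vectors in the range of \<open>Z\<close> or of
  \<open>V\<close>.\<close>

lemma subspace_dist_projection_diff:
  assumes Z: "Z \<in> carrier_mat n r" and V: "V \<in> carrier_mat n r" and x: "x \<in> carrier_vec n"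
  defines "d \<equiv> Z *\<^sub>v (Z\<^sup>T *\<^sub>v x) - V *\<^sub>v (V\<^sup>T *\<^sub>v x)"
  shows "d \<bullet> d \<le> (subspace_dist Z V)\<^sup>2 * (x \<bullet> x)"
proof -
  have "Z * Z\<^sup>T - V * V\<^sup>T \<in> carrier_mat n n" using V by auto
  from spectral_norm_upper_sq[OF this x] show ?thesis
    unfolding projection_diff_mult_vec[OF Z V x] subspace_dist_def d_def .
qed

text \<open>For \<open>x\<close> orthogonal to \<open>Z\<close> the difference of the projections is
  just -V V^T x, which has the length of V^T x.\<close>

lemma subspace_dist_orthogonal_vec:
  assumes Z: "Z \<in> carrier_mat n r" and V: "V \<in> carrier_mat n r" "V\<^sup>T * V = 1\<^sub>m r"
    and x: "x \<in> carrier_vec n" and Zx: "Z\<^sup>T *\<^sub>v x = 0\<^sub>v r"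
  shows "(V\<^sup>T *\<^sub>v x) \<bullet> (V\<^sup>T *\<^sub>v x) \<le> (subspace_dist Z V)\<^sup>2 * (x \<bullet> x)"
proof -
  have w: "V\<^sup>T *\<^sub>v x \<in> carrier_vec r" "V *\<^sub>v (V\<^sup>T *\<^sub>v x) \<in> carrier_vec n" using V x by auto
  have "Z *\<^sub>v 0\<^sub>v r = 0\<^sub>v n" using Z by (intro eq_vecI) auto
  then show ?thesis
    using subspace_dist_projection_diff[OF Z V(1) x] Zx w orthonormal_isometry[OF V w(1) w(1)]
    by (simp add: minus_scalar_prod_distrib[of _ n] scalar_prod_minus_distrib[of _ n])
qed

text \<open>A vector in one of the subspaces is fixed by its own projection, so the difference of
  the projections is, up to sign, its residual with respect to the other subspace, and Pythagoras
  gives the left-hand sides. Thus |V^T Z w| and |Z^T V w| are at least cos theta times |w|.\<close>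

lemma subspace_dist_residual:
  assumes Z: "Z \<in> carrier_mat n r" "Z\<^sup>T * Z = 1\<^sub>m r" and V: "V \<in> carrier_mat n r" "V\<^sup>T * V = 1\<^sub>m r"
    and w: "w \<in> carrier_vec r"
  shows "w \<bullet> w - (V\<^sup>T *\<^sub>v (Z *\<^sub>v w)) \<bullet> (V\<^sup>T *\<^sub>v (Z *\<^sub>v w)) \<le> (subspace_dist Z V)\<^sup>2 * (w \<bullet> w)"
    and "w \<bullet> w - (Z\<^sup>T *\<^sub>v (V *\<^sub>v w)) \<bullet> (Z\<^sup>T *\<^sub>v (V *\<^sub>v w)) \<le> (subspace_dist Z V)\<^sup>2 * (w \<bullet> w)"
proof -
  have z: "Z *\<^sub>v w \<in> carrier_vec n" "V *\<^sub>v w \<in> carrier_vec n" using Z V w by auto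
  have Zw: "Z\<^sup>T *\<^sub>v (Z *\<^sub>v w) = w"
    using assoc_mult_mat_vec[of "Z\<^sup>T" r n Z r w] Z w by simp
  have Vw: "V\<^sup>T *\<^sub>v (V *\<^sub>v w) = w"
    using assoc_mult_mat_vec[of "V\<^sup>T" r n V r w] V w by simp
  show "w \<bullet> w - (V\<^sup>T *\<^sub>v (Z *\<^sub>v w)) \<bullet> (V\<^sup>T *\<^sub>v (Z *\<^sub>v w)) \<le> (subspace_dist Z V)\<^sup>2 * (w \<bullet> w)"
    using subspace_dist_projection_diff[OF Z(1) V(1) z(1)] orthonormal_projection_residual[OF V z(1)]
      orthonormal_isometry[OF Z w w] Zw by simp
  define q where "q = Z *\<^sub>v (Z\<^sup>T *\<^sub>v (V *\<^sub>v w))"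
  have q: "q \<in> carrier_vec n" using Z z by (auto simp: q_def)
  \<comment> \<open>The distance inequality has the projection onto \<open>Z\<close> first, the
    residual formula has it second; the squared length does not see the sign.\<close>
  have "(q - V *\<^sub>v w) \<bullet> (q - V *\<^sub>v w) = (V *\<^sub>v w - q) \<bullet> (V *\<^sub>v w - q)"
    using q z by (simp add: minus_scalar_prod_distrib[of _ n] scalar_prod_minus_distrib[of _ n])
  then show "w \<bullet> w - (Z\<^sup>T *\<^sub>v (V *\<^sub>v w)) \<bullet> (Z\<^sup>T *\<^sub>v (V *\<^sub>v w)) \<le> (subspace_dist Z V)\<^sup>2 * (w \<bullet> w)"
    using subspace_dist_projection_diff[OF Z(1) V(1) z(2)] orthonormal_projection_residual[OF Z z(2)]
      orthonormal_isometry[OF V w w] Vw unfolding q_def by simp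
qed

section \<open>Diagonal matrices\<close>

lemma spectrum_mat_diag: "spectrum (mat_diag n (f :: nat \<Rightarrow> 'a :: field)) = f ` {..<n}"
proof -
  have c: "mat_diag n f \<in> carrier_mat n n" by simp
  have "upper_triangular (mat_diag n f)" by (auto simp: upper_triangular_def mat_diag_def)
  moreover have "diag_mat (mat_diag n f) = map f [0..<n]"
    by (auto simp: diag_mat_def mat_diag_def)
  ultimately have "char_poly (mat_diag n f) = (\<Prod>a\<leftarrow>map f [0..<n]. [:- a, 1:])"
    using char_poly_upper_triangular[OF c] by simp
  then show ?thesis
    unfolding spectrum_root_char_poly[OF c] by (auto simp: poly_prod_list prod_list_zero_iff image_iff)
qed

lemma lambda_mat_diag_bounds:
  assumes "i < n"
  shows "lambda_min (mat_diag n f) \<le> f i" "f i \<le> lambda_max (mat_diag n f)"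
  using assms unfolding lambda_min_def lambda_max_def spectrum_mat_diag by auto

lemma mat_diag_mult_vec:
  assumes "y \<in> carrier_vec n"
  shows "mat_diag n f *\<^sub>v y = vec n (\<lambda>i. f i * y $ i)"
  using assms by (intro eq_vecI)
    (auto simp: mat_diag_def scalar_prod_def if_distrib[of "\<lambda>a. a * _"] cong: if_cong)

section \<open>The spectral splitting of A along V and V_perp\<close>

locale orthogonal_splitting =
  fixes n r :: nat and V Vp A :: "real mat" and lam :: "nat \<Rightarrow> real"
  assumes r: "1 \<le> r" "r < n"
    and A: "sym_pos_def n A"
    and V: "V \<in> carrier_mat n r"
    and Vp: "Vp \<in> carrier_mat n (n - r)"
    and orth: "orthonormal_cols (hconcat V Vp)"
    and decomp: "A = V * mat_diag r lam * V\<^sup>T + Vp * mat_diag (n - r) (\<lambda>i. lam (r + i)) * Vp\<^sup>T"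
    and ordered: "\<forall>i<r. \<forall>j\<in>{r..<n}. lam i \<le> lam j"
begin

abbreviation Lam where "Lam \<equiv> mat_diag r lam"
abbreviation Lamp where "Lamp \<equiv> mat_diag (n - r) (\<lambda>i. lam (r + i))"

lemma A_carrier: "A \<in> carrier_mat n n" and A_sym: "A\<^sup>T = A"
  and A_pos: "x \<in> carrier_vec n \<Longrightarrow> x \<noteq> 0\<^sub>v n \<Longrightarrow> 0 < x \<bullet> (A *\<^sub>v x)"
  using A unfolding sym_pos_def_def by auto

lemma hconcat_carrier: "hconcat V Vp \<in> carrier_mat n n"
  using r V Vp unfolding hconcat_def by auto

lemma hconcat_index:
  assumes "i < n" "j < n"
  shows "hconcat V Vp $$ (i, j) = (if j < r then V $$ (i, j) else Vp $$ (i, j - r))"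
  using r V Vp assms unfolding hconcat_def by (auto simp: mat_of_cols_index nth_append)

lemma hconcat_gram: "(hconcat V Vp)\<^sup>T * hconcat V Vp = 1\<^sub>m n"
  using orth hconcat_carrier unfolding orthonormal_cols_def by auto

lemma VtV: "V\<^sup>T * V = 1\<^sub>m r"
proof (rule eq_matI)
  fix i j assume "i < dim_row (1\<^sub>m r)" "j < dim_col (1\<^sub>m r)"
  then have ij: "i < r" "j < r" by auto
  have "((hconcat V Vp)\<^sup>T * hconcat V Vp) $$ (i, j) = (V\<^sup>T * V) $$ (i, j)"
    using ij r V hconcat_carrier by (simp add: scalar_prod_def hconcat_index)
  then show "(V\<^sup>T * V) $$ (i, j) = 1\<^sub>m r $$ (i, j)" unfolding hconcat_gram using ij r by simp
qed (use V in auto)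

text \<open>A square matrix with orthonormal columns has orthonormal rows as well, since a one-sided
  inverse is two-sided. The sum over the columns is then cut at \<open>r\<close>.\<close>

lemma resolution: "V * V\<^sup>T + Vp * Vp\<^sup>T = 1\<^sub>m n"
proof -
  have "hconcat V Vp * (hconcat V Vp)\<^sup>T = 1\<^sub>m n"
    using mat_mult_left_right_inverse[OF _ hconcat_carrier hconcat_gram] hconcat_carrier by simp
  moreover have "hconcat V Vp * (hconcat V Vp)\<^sup>T = V * V\<^sup>T + Vp * Vp\<^sup>T"
  proof (rule eq_matI)
    fix i j assume "i < dim_row (V * V\<^sup>T + Vp * Vp\<^sup>T)" "j < dim_col (V * V\<^sup>T + Vp * Vp\<^sup>T)"
    then have ij: "i < n" "j < n" using Vp by auto
    have "(hconcat V Vp * (hconcat V Vp)\<^sup>T) $$ (i, j)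
        = (\<Sum>k = 0..<n. hconcat V Vp $$ (i, k) * hconcat V Vp $$ (j, k))"
      using ij hconcat_carrier by (simp add: scalar_prod_def)
    also have "\<dots> = (\<Sum>k = 0..<r. hconcat V Vp $$ (i, k) * hconcat V Vp $$ (j, k))
        + (\<Sum>k = r..<n. hconcat V Vp $$ (i, k) * hconcat V Vp $$ (j, k))"
      using r by (simp add: sum.atLeastLessThan_concat)
    also have "(\<Sum>k = r..<n. hconcat V Vp $$ (i, k) * hconcat V Vp $$ (j, k))
        = (\<Sum>k = 0..<n - r. hconcat V Vp $$ (i, k + r) * hconcat V Vp $$ (j, k + r))"
      using sum.shift_bounds_nat_ivl[of "\<lambda>k. hconcat V Vp $$ (i, k) * hconcat V Vp $$ (j, k)" 0 r "n - r"] r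
      by simp
    finally show "(hconcat V Vp * (hconcat V Vp)\<^sup>T) $$ (i, j) = (V * V\<^sup>T + Vp * Vp\<^sup>T) $$ (i, j)"
      using ij r V Vp by (simp add: scalar_prod_def hconcat_index)
  qed (use V Vp hconcat_carrier in auto)
  ultimately show ?thesis by simp
qed

lemma Vt_carrier: "x \<in> carrier_vec n \<Longrightarrow> V\<^sup>T *\<^sub>v x \<in> carrier_vec r"
  and Vpt_carrier: "x \<in> carrier_vec n \<Longrightarrow> Vp\<^sup>T *\<^sub>v x \<in> carrier_vec (n - r)"
  using V Vp by auto

lemma scalar_prod_split:
  assumes x: "x \<in> carrier_vec n" and z: "z \<in> carrier_vec n"
  shows "x \<bullet> z = (V\<^sup>T *\<^sub>v x) \<bullet> (V\<^sup>T *\<^sub>v z) + (Vp\<^sup>T *\<^sub>v x) \<bullet> (Vp\<^sup>T *\<^sub>v z)"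
proof -
  have "z = (V * V\<^sup>T + Vp * Vp\<^sup>T) *\<^sub>v z" unfolding resolution using z by simp
  also have "\<dots> = V *\<^sub>v (V\<^sup>T *\<^sub>v z) + Vp *\<^sub>v (Vp\<^sup>T *\<^sub>v z)"
    using V Vp z by (subst add_mult_distrib_mat_vec[of _ n n])
      (auto simp: assoc_mult_mat_vec[of V n r] assoc_mult_mat_vec[of Vp n "n - r"])
  finally have "x \<bullet> z = x \<bullet> (V *\<^sub>v (V\<^sup>T *\<^sub>v z) + Vp *\<^sub>v (Vp\<^sup>T *\<^sub>v z))" by simp
  also have "\<dots> = x \<bullet> (V *\<^sub>v (V\<^sup>T *\<^sub>v z)) + x \<bullet> (Vp *\<^sub>v (Vp\<^sup>T *\<^sub>v z))"
    using x V Vp z by (intro scalar_prod_add_distrib[of _ n]) auto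
  finally show ?thesis
    unfolding scalar_prod_transpose[OF V x Vt_carrier[OF z]]
      scalar_prod_transpose[OF Vp x Vpt_carrier[OF z]] .
qed

lemma A_form:
  assumes x: "x \<in> carrier_vec n" and z: "z \<in> carrier_vec n"
  shows "x \<bullet> (A *\<^sub>v z) = (V\<^sup>T *\<^sub>v x) \<bullet> (Lam *\<^sub>v (V\<^sup>T *\<^sub>v z)) + (Vp\<^sup>T *\<^sub>v x) \<bullet> (Lamp *\<^sub>v (Vp\<^sup>T *\<^sub>v z))"
proof -
  have c: "Lam *\<^sub>v (V\<^sup>T *\<^sub>v z) \<in> carrier_vec r" "Lamp *\<^sub>v (Vp\<^sup>T *\<^sub>v z) \<in> carrier_vec (n - r)"
    using mult_mat_vec_carrier[OF mat_diag_dim Vt_carrier[OF z]]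
      mult_mat_vec_carrier[OF mat_diag_dim Vpt_carrier[OF z]] by auto
  have c1: "V * Lam \<in> carrier_mat n r" "Vp * Lamp \<in> carrier_mat n (n - r)"
    using V Vp by (auto intro!: mult_carrier_mat)
  have c2: "V * Lam * V\<^sup>T \<in> carrier_mat n n" "Vp * Lamp * Vp\<^sup>T \<in> carrier_mat n n"
    using c1 V Vp by (auto intro!: mult_carrier_mat simp del: assoc_mult_mat)
  have "V * Lam * V\<^sup>T *\<^sub>v z = V *\<^sub>v (Lam *\<^sub>v (V\<^sup>T *\<^sub>v z))"
    using assoc_mult_mat_vec[OF c1(1), of "V\<^sup>T" n z] assoc_mult_mat_vec[OF V mat_diag_dim Vt_carrier[OF z]] V z
    by simp
  moreover have "Vp * Lamp * Vp\<^sup>T *\<^sub>v z = Vp *\<^sub>v (Lamp *\<^sub>v (Vp\<^sup>T *\<^sub>v z))"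
    using assoc_mult_mat_vec[OF c1(2), of "Vp\<^sup>T" n z] assoc_mult_mat_vec[OF Vp mat_diag_dim Vpt_carrier[OF z]] Vp z
    by simp
  ultimately have "A *\<^sub>v z = V *\<^sub>v (Lam *\<^sub>v (V\<^sup>T *\<^sub>v z)) + Vp *\<^sub>v (Lamp *\<^sub>v (Vp\<^sup>T *\<^sub>v z))"
    unfolding decomp using add_mult_distrib_mat_vec[OF c2 z] by simp
  then have "x \<bullet> (A *\<^sub>v z) = x \<bullet> (V *\<^sub>v (Lam *\<^sub>v (V\<^sup>T *\<^sub>v z))) + x \<bullet> (Vp *\<^sub>v (Lamp *\<^sub>v (Vp\<^sup>T *\<^sub>v z)))"
    using x c V Vp by (simp add: scalar_prod_add_distrib[of _ n])
  then show ?thesis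
    unfolding scalar_prod_transpose[OF V x c(1)] scalar_prod_transpose[OF Vp x c(2)] .
qed

lemma scalar_prod_mat_diag:
  fixes a b :: "real vec"
  assumes "a \<in> carrier_vec m" "b \<in> carrier_vec m"
  shows "a \<bullet> (mat_diag m f *\<^sub>v b) = (\<Sum>i<m. f i * (a $ i * b $ i))"
  using assms by (auto simp: mat_diag_mult_vec scalar_prod_def atLeast0LessThan mult_ac)

lemma scalar_prod_self_sum:
  fixes a :: "real vec"
  assumes "a \<in> carrier_vec m"
  shows "a \<bullet> a = (\<Sum>i<m. (a $ i)\<^sup>2)"
  using assms by (auto simp: scalar_prod_def atLeast0LessThan power2_eq_square)

text \<open>The second identity is a matter of length: V e_i is a unit vector whose component along
  \<open>V\<close> already has length 1, so nothing is left for \<open>Vp\<close>.\<close>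

lemma V_unit:
  assumes i: "i < r"
  shows "V\<^sup>T *\<^sub>v (V *\<^sub>v unit_vec r i) = unit_vec r i" "Vp\<^sup>T *\<^sub>v (V *\<^sub>v unit_vec r i) = 0\<^sub>v (n - r)"
proof -
  let ?v = "V *\<^sub>v unit_vec r i"
  have v: "?v \<in> carrier_vec n" using V by auto
  show *: "V\<^sup>T *\<^sub>v ?v = unit_vec r i"
    using assoc_mult_mat_vec[of "V\<^sup>T" r n V r "unit_vec r i"] V VtV by simp
  have "?v \<bullet> ?v = unit_vec r i \<bullet> unit_vec r i"
    by (rule orthonormal_isometry[OF V VtV]) auto
  then have "(Vp\<^sup>T *\<^sub>v ?v) \<bullet> (Vp\<^sup>T *\<^sub>v ?v) = 0"
    using scalar_prod_split[OF v v] unfolding * by simp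
  then show "Vp\<^sup>T *\<^sub>v ?v = 0\<^sub>v (n - r)" using scalar_prod_self_eq_0_iff[OF Vpt_carrier[OF v]] by simp
qed

text \<open>For i < r this is the Rayleigh quotient of \<open>A\<close> at the i-th column of
  \<open>V\<close>. The other entries are at least \<open>lam 0\<close>, which belongs to the first
  block because \<open>1 \<le> r\<close>.\<close>

lemma lam_pos:
  assumes i: "i < n"
  shows "0 < lam i"
proof -
  have *: "0 < lam i" if i: "i < r" for i
  proof -
    let ?v = "V *\<^sub>v unit_vec r i"
    have v: "?v \<in> carrier_vec n" using V by auto
    have "V\<^sup>T *\<^sub>v 0\<^sub>v n = 0\<^sub>v r" using V by (intro eq_vecI) auto
    then have "?v \<noteq> 0\<^sub>v n" using V_unit(1)[OF i] i by (metis unit_vec_nonzero)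
    from A_pos[OF v this] have "0 < ?v \<bullet> (A *\<^sub>v ?v)" .
    also have "\<dots> = lam i"
      unfolding A_form[OF v v] V_unit[OF i] using i
      by (simp add: scalar_prod_mat_diag unit_vec_def if_distrib[of "\<lambda>a. a * _"] if_distrib[of "\<lambda>a. _ * a"] cong: if_cong)
    finally show ?thesis .
  qed
  show ?thesis
  proof (cases "i < r")
    case True then show ?thesis by (rule *)
  next
    case False
    then have "lam 0 \<le> lam i" using ordered r i by simp
    then show ?thesis using *[of 0] r by simp
  qed
qed

lemma lam_le_max: "i < n \<Longrightarrow> lam i \<le> lambda_max Lamp"
proof -
  have top: "lam j \<le> lambda_max Lamp" if "r \<le> j" "j < n" for j
    using lambda_mat_diag_bounds(2)[of "j - r" "n - r" "\<lambda>i. lam (r + i)"] that by simp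
  assume "i < n"
  \<comment> \<open>An entry of the first block is compared with \<open>lam r\<close>, the first
    entry of \<open>Lamp\<close>, which exists because \<open>r < n\<close>.\<close>
  then show ?thesis using top[of i] top[of r] ordered r by (cases "i < r") force+
qed

lemma min_le_lam: "i < n - r \<Longrightarrow> lambda_min Lamp \<le> lam (r + i)"
  using lambda_mat_diag_bounds(1)[of i "n - r" "\<lambda>i. lam (r + i)"] by simp

lemma lambda_max_pos: "0 < lambda_max Lamp" and lambda_min_le_max: "lambda_min Lamp \<le> lambda_max Lamp"
  using lam_pos[of 0] lam_le_max[of 0] lam_le_max[of r] min_le_lam[of 0] r by auto

lemma lambda_min_pos: "0 < lambda_min Lamp"
  using r lam_pos unfolding lambda_min_def spectrum_mat_diag by (subst Min_gr_iff) (auto simp: lessThan_empty_iff)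

lemma A_form_self:
  assumes x: "x \<in> carrier_vec n"
  shows "x \<bullet> (A *\<^sub>v x) = (\<Sum>i<r. lam i * ((V\<^sup>T *\<^sub>v x) $ i)\<^sup>2) + (\<Sum>i<n - r. lam (r + i) * ((Vp\<^sup>T *\<^sub>v x) $ i)\<^sup>2)"
  using A_form[OF x x] scalar_prod_mat_diag[OF Vt_carrier Vt_carrier, OF x x]
    scalar_prod_mat_diag[OF Vpt_carrier Vpt_carrier, OF x x] by (simp add: power2_eq_square)

lemma A_upper:
  assumes x: "x \<in> carrier_vec n"
  shows "x \<bullet> (A *\<^sub>v x) \<le> lambda_max Lamp * (x \<bullet> x)"
proof -
  have "(\<Sum>i<r. lam i * ((V\<^sup>T *\<^sub>v x) $ i)\<^sup>2) \<le> lambda_max Lamp * ((V\<^sup>T *\<^sub>v x) \<bullet> (V\<^sup>T *\<^sub>v x))"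
    unfolding scalar_prod_self_sum[OF Vt_carrier[OF x]] sum_distrib_left
    using r by (intro sum_mono mult_right_mono lam_le_max) auto
  moreover have "(\<Sum>i<n - r. lam (r + i) * ((Vp\<^sup>T *\<^sub>v x) $ i)\<^sup>2) \<le> lambda_max Lamp * ((Vp\<^sup>T *\<^sub>v x) \<bullet> (Vp\<^sup>T *\<^sub>v x))"
    unfolding scalar_prod_self_sum[OF Vpt_carrier[OF x]] sum_distrib_left
    using r by (intro sum_mono mult_right_mono lam_le_max) auto
  ultimately show ?thesis
    unfolding A_form_self[OF x] scalar_prod_split[OF x x] by (simp add: distrib_left)
qed

text \<open>The nonnegative \<open>Vp\<close> half of the form is dropped. The weights
  \<open>lam i\<close> are kept and not replaced by a minimum, because \<open>W_bound\<close> needs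
  the weighted sum.\<close>

lemma A_lower_V:
  assumes x: "x \<in> carrier_vec n"
  shows "(\<Sum>i<r. lam i * ((V\<^sup>T *\<^sub>v x) $ i)\<^sup>2) \<le> x \<bullet> (A *\<^sub>v x)"
proof -
  have "0 \<le> (\<Sum>i<n - r. lam (r + i) * ((Vp\<^sup>T *\<^sub>v x) $ i)\<^sup>2)"
    using lam_pos by (intro sum_nonneg mult_nonneg_nonneg) (auto intro: less_imp_le)
  then show ?thesis unfolding A_form_self[OF x] by simp
qed

lemma A_lower_Vp:
  assumes x: "x \<in> carrier_vec n"
  shows "lambda_min Lamp * ((Vp\<^sup>T *\<^sub>v x) \<bullet> (Vp\<^sup>T *\<^sub>v x)) \<le> x \<bullet> (A *\<^sub>v x)"
proof -
  have "0 \<le> (\<Sum>i<r. lam i * ((V\<^sup>T *\<^sub>v x) $ i)\<^sup>2)"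
    using lam_pos r by (intro sum_nonneg mult_nonneg_nonneg) (auto intro: less_imp_le)
  moreover have "lambda_min Lamp * ((Vp\<^sup>T *\<^sub>v x) \<bullet> (Vp\<^sup>T *\<^sub>v x)) \<le> (\<Sum>i<n - r. lam (r + i) * ((Vp\<^sup>T *\<^sub>v x) $ i)\<^sup>2)"
    unfolding scalar_prod_self_sum[OF Vpt_carrier[OF x]] sum_distrib_left
    by (intro sum_mono mult_right_mono min_le_lam) auto
  ultimately show ?thesis unfolding A_form_self[OF x] by simp
qed

end

section \<open>The deflated matrix S and its kernel\<close>

locale deflation = orthogonal_splitting +
  fixes Z :: "real mat"
  assumes Z: "Z \<in> carrier_mat n r" and ZtZ: "Z\<^sup>T * Z = 1\<^sub>m r"
begin

definition E where "E = Z\<^sup>T * A * Z"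
definition Einv where "Einv = the (mat_inverse E)"
definition S where "S = (1\<^sub>m n - A * Z * Einv * Z\<^sup>T) * A"
definition W where "W = Z\<^sup>T * A"

lemma W_carrier: "W \<in> carrier_mat r n" and E_carrier: "E \<in> carrier_mat r r"
  using Z A_carrier by (auto simp: W_def E_def)

lemma W_transpose: "W\<^sup>T = A * Z"
  using transpose_mult[of "Z\<^sup>T" r n A n] Z A_carrier A_sym by (simp add: W_def)

lemma WZ: "W * Z = E" and ZtWt: "Z\<^sup>T * W\<^sup>T = E"
proof -
  show "W * Z = E" by (simp add: W_def E_def)
  show "Z\<^sup>T * W\<^sup>T = E"
    unfolding W_transpose E_def using Z A_carrier by (simp add: assoc_mult_mat[of _ r n _ n _ r])
qed

lemma E_sym: "E\<^sup>T = E"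
  using transpose_mult[OF W_carrier Z] unfolding WZ ZtWt .

lemma Z_mult_vec: "w \<in> carrier_vec r \<Longrightarrow> Z *\<^sub>v w \<in> carrier_vec n"
  using Z by auto

lemma W_mult_vec:
  assumes "x \<in> carrier_vec n"
  shows "W *\<^sub>v x = Z\<^sup>T *\<^sub>v (A *\<^sub>v x)" "W *\<^sub>v x \<in> carrier_vec r"
proof -
  show "W *\<^sub>v x = Z\<^sup>T *\<^sub>v (A *\<^sub>v x)"
    unfolding W_def by (rule assoc_mult_mat_vec[of _ r n _ n]) (use Z A_carrier assms in auto)
  show "W *\<^sub>v x \<in> carrier_vec r" using W_carrier assms by auto
qed

lemma Wt_mult_vec:
  assumes "w \<in> carrier_vec r"
  shows "W\<^sup>T *\<^sub>v w = A *\<^sub>v (Z *\<^sub>v w)"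
  unfolding W_transpose by (rule assoc_mult_mat_vec[of _ n n _ r]) (use Z A_carrier assms in auto)

lemma E_form:
  assumes w: "w \<in> carrier_vec r"
  shows "w \<bullet> (E *\<^sub>v w) = (Z *\<^sub>v w) \<bullet> (A *\<^sub>v (Z *\<^sub>v w))"
proof -
  have "E *\<^sub>v w = Z\<^sup>T *\<^sub>v (A *\<^sub>v (Z *\<^sub>v w))"
    using assoc_mult_mat_vec[OF W_carrier Z w] W_mult_vec(1)[OF Z_mult_vec[OF w]] unfolding WZ by simp
  moreover have "w \<bullet> (Z\<^sup>T *\<^sub>v (A *\<^sub>v (Z *\<^sub>v w))) = (Z\<^sup>T\<^sup>T *\<^sub>v w) \<bullet> (A *\<^sub>v (Z *\<^sub>v w))"
    by (rule scalar_prod_transpose[of _ r n]) (use Z A_carrier w in auto)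
  ultimately show ?thesis by simp
qed

lemma Z_inject: "w \<in> carrier_vec r \<Longrightarrow> Z\<^sup>T *\<^sub>v (Z *\<^sub>v w) = w"
  using assoc_mult_mat_vec[of "Z\<^sup>T" r n Z r w] Z ZtZ by simp

lemma E_form_nonneg:
  assumes w: "w \<in> carrier_vec r"
  shows "0 \<le> w \<bullet> (E *\<^sub>v w)"
  unfolding E_form[OF w] using A_pos[OF Z_mult_vec[OF w]]
  by (cases "Z *\<^sub>v w = 0\<^sub>v n") (use A_carrier in \<open>auto simp: less_imp_le\<close>)

text \<open>If E w = 0, then Z w has A-energy 0 and vanishes, and so does w as \<open>Z\<close> is
  injective. This is what makes \<open>the (mat_inverse E)\<close> a genuine inverse.\<close>

lemma det_E: "det E \<noteq> 0"
proof
  assume "det E = 0"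
  then obtain w where w: "w \<in> carrier_vec r" "w \<noteq> 0\<^sub>v r" "E *\<^sub>v w = 0\<^sub>v r"
    using det_0_iff_vec_prod_zero[OF E_carrier] by auto
  have "w \<bullet> (E *\<^sub>v w) = 0" using w by simp
  then have "Z *\<^sub>v w = 0\<^sub>v n"
    using A_pos[OF Z_mult_vec[OF w(1)]] unfolding E_form[OF w(1)] by force
  moreover have "Z\<^sup>T *\<^sub>v 0\<^sub>v n = 0\<^sub>v r" using Z by (intro eq_vecI) auto
  ultimately show False using Z_inject[OF w(1)] w(2) by simp
qed

lemma Einv: "E * Einv = 1\<^sub>m r" "Einv * E = 1\<^sub>m r" "Einv \<in> carrier_mat r r"
proof -
  have "mat_inverse E \<noteq> None"
    using mat_inverse(1)[OF E_carrier, of "()"] det_non_zero_imp_unit[OF E_carrier det_E, of "()"] by blast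
  then have "mat_inverse E = Some Einv" by (auto simp: Einv_def)
  from mat_inverse(2)[OF E_carrier this]
  show "E * Einv = 1\<^sub>m r" "Einv * E = 1\<^sub>m r" "Einv \<in> carrier_mat r r" by auto
qed

lemma Einv_sym: "Einv\<^sup>T = Einv"
proof -
  have "Einv\<^sup>T * E = 1\<^sub>m r" using transpose_mult[OF E_carrier Einv(3)] E_sym Einv(1) by simp
  have "Einv\<^sup>T = Einv\<^sup>T * (E * Einv)" using Einv by simp
  also have "\<dots> = Einv\<^sup>T * E * Einv"
    by (rule assoc_mult_mat[symmetric, of _ r r _ r _ r]) (use Einv E_carrier in auto)
  finally show ?thesis unfolding \<open>Einv\<^sup>T * E = 1\<^sub>m r\<close> using Einv by simp
qed

lemma Einv_form_nonneg:
  assumes w: "w \<in> carrier_vec r"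
  shows "0 \<le> w \<bullet> (Einv *\<^sub>v w)"
proof -
  \<comment> \<open>Substituting w = E u turns the form of the inverse into that of \<open>E\<close>
    at u.\<close>
  define u where "u = Einv *\<^sub>v w"
  have u: "u \<in> carrier_vec r" using Einv w by (auto simp: u_def)
  have "E *\<^sub>v u = w"
    unfolding u_def using assoc_mult_mat_vec[OF E_carrier Einv(3) w] Einv(1) w by simp
  then have "w \<bullet> u = u \<bullet> (E *\<^sub>v u)" using comm_scalar_prod[OF w u] by simp
  then show ?thesis using E_form_nonneg[OF u] by (simp add: u_def)
qed

text \<open>In this form the symmetry of \<open>S\<close> is visible, and \<open>S\<close> is
  \<open>A\<close> minus a positive semidefinite matrix.\<close>

lemma S_alt: "S = A - W\<^sup>T * (Einv * W)"
proof -
  have c: "A * Z * Einv \<in> carrier_mat n r" "A * Z * Einv * Z\<^sup>T \<in> carrier_mat n n"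
    using Z Einv(3) A_carrier by auto
  have "S = 1\<^sub>m n * A - A * Z * Einv * Z\<^sup>T * A"
    unfolding S_def by (rule minus_mult_distrib_mat[of _ n n _ _ n]) (use c A_carrier in auto)
  also have "A * Z * Einv * Z\<^sup>T * A = A * Z * Einv * W"
    unfolding W_def by (rule assoc_mult_mat[OF c(1) _ A_carrier]) (use Z in auto)
  also have "\<dots> = A * Z * (Einv * W)"
    by (rule assoc_mult_mat[OF _ Einv(3) W_carrier]) (use Z A_carrier in auto)
  finally show ?thesis unfolding W_transpose using A_carrier by simp
qed

lemma WtEW_carrier: "W\<^sup>T * (Einv * W) \<in> carrier_mat n n"
  using W_carrier Einv(3) by auto

lemma S_carrier: "S \<in> carrier_mat n n"
  unfolding S_alt by (rule minus_carrier_mat[OF WtEW_carrier])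

lemma S_sym: "S\<^sup>T = S"
proof -
  have "(Einv * W)\<^sup>T = W\<^sup>T * Einv"
    using transpose_mult[OF Einv(3) W_carrier] Einv_sym by simp
  then have "(W\<^sup>T * (Einv * W))\<^sup>T = W\<^sup>T * Einv * W"
    using transpose_mult[of "W\<^sup>T" n r "Einv * W" n] W_carrier Einv(3) by simp
  also have "\<dots> = W\<^sup>T * (Einv * W)"
    by (rule assoc_mult_mat[of _ n r _ r _ n]) (use W_carrier Einv in auto)
  finally show ?thesis
    unfolding S_alt using transpose_minus[OF A_carrier WtEW_carrier] A_sym by simp
qed

lemma S_mult_vec:
  assumes x: "x \<in> carrier_vec n"
  shows "S *\<^sub>v x = A *\<^sub>v x - A *\<^sub>v (Z *\<^sub>v (Einv *\<^sub>v (W *\<^sub>v x)))"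
proof -
  have "S *\<^sub>v x = A *\<^sub>v x - (W\<^sup>T * (Einv * W)) *\<^sub>v x"
    unfolding S_alt by (rule minus_mult_distrib_mat_vec[OF A_carrier WtEW_carrier x])
  also have "(W\<^sup>T * (Einv * W)) *\<^sub>v x = W\<^sup>T *\<^sub>v ((Einv * W) *\<^sub>v x)"
    by (rule assoc_mult_mat_vec[of _ n r _ n]) (use W_carrier Einv x in auto)
  also have "(Einv * W) *\<^sub>v x = Einv *\<^sub>v (W *\<^sub>v x)"
    by (rule assoc_mult_mat_vec[OF Einv(3) W_carrier x])
  also have "W\<^sup>T *\<^sub>v \<dots> = A *\<^sub>v (Z *\<^sub>v \<dots>)"
    by (rule Wt_mult_vec) (use Einv W_mult_vec[OF x] in auto)
  finally show ?thesis .
qed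

lemma SZ: "S * Z = 0\<^sub>m n r"
proof -
  have "S * Z = A * Z - W\<^sup>T * (Einv * W) * Z"
    unfolding S_alt by (rule minus_mult_distrib_mat[OF A_carrier WtEW_carrier Z])
  also have "W\<^sup>T * (Einv * W) * Z = W\<^sup>T * ((Einv * W) * Z)"
    by (rule assoc_mult_mat[of _ n r _ n _ r]) (use W_carrier Einv Z in auto)
  also have "Einv * W * Z = Einv * (W * Z)"
    by (rule assoc_mult_mat[OF Einv(3) W_carrier Z])
  also have "\<dots> = 1\<^sub>m r" unfolding WZ by (rule Einv(2))
  finally show ?thesis unfolding W_transpose using A_carrier Z by simp
qed

lemma Zt_S_mult_vec:
  assumes x: "x \<in> carrier_vec n"
  shows "Z\<^sup>T *\<^sub>v (S *\<^sub>v x) = 0\<^sub>v r"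
proof -
  have "Z\<^sup>T *\<^sub>v (S *\<^sub>v x) = (Z\<^sup>T * S) *\<^sub>v x"
    by (rule assoc_mult_mat_vec[symmetric, of _ r n]) (use Z S_carrier x in auto)
  also have "Z\<^sup>T * S = (S * Z)\<^sup>T"
    using transpose_mult[OF S_carrier Z] S_sym by simp
  finally show ?thesis unfolding SZ using x by (intro eq_vecI) auto
qed

text \<open>Injectivity of S + Z Z^T: applying Z^T kills the term with \<open>S\<close> and leaves
  Z^T x = 0, hence S x = 0. By \<open>S_mult_vec\<close> this reads A (x - Z y) = 0 with y = E^-1 W
  x, so x = Z y lies in the range of \<open>Z\<close>, to which it is also orthogonal.\<close>

lemma order_0_S: "order 0 (char_poly S) = r"
proof (rule order_0_char_poly[OF S_carrier Z ZtZ SZ])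
  fix x assume x: "x \<in> carrier_vec n" and 0: "S *\<^sub>v x + Z *\<^sub>v (Z\<^sup>T *\<^sub>v x) = 0\<^sub>v n"
  define w where "w = Z\<^sup>T *\<^sub>v x"
  define y where "y = Einv *\<^sub>v (W *\<^sub>v x)"
  have w: "w \<in> carrier_vec r" "Z *\<^sub>v w \<in> carrier_vec n" using Z x by (auto simp: w_def)
  have y: "y \<in> carrier_vec r" using Einv(3) W_mult_vec[OF x] by (auto simp: y_def)
  have z: "Z *\<^sub>v y \<in> carrier_vec n" "x - Z *\<^sub>v y \<in> carrier_vec n" using Z_mult_vec[OF y] x by auto
  have Sx: "S *\<^sub>v x \<in> carrier_vec n" using S_carrier x by auto
  have "Z\<^sup>T *\<^sub>v (S *\<^sub>v x + Z *\<^sub>v w) = Z\<^sup>T *\<^sub>v (S *\<^sub>v x) + Z\<^sup>T *\<^sub>v (Z *\<^sub>v w)"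
    by (rule mult_add_distrib_mat_vec[of _ r n]) (use Z Sx w in auto)
  then have "Z\<^sup>T *\<^sub>v 0\<^sub>v n = w"
    using 0 Zt_S_mult_vec[OF x] Z_inject[OF w(1)] w unfolding w_def[symmetric] by simp
  moreover have "Z\<^sup>T *\<^sub>v 0\<^sub>v n = 0\<^sub>v r" using Z by (intro eq_vecI) auto
  ultimately have w0: "w = 0\<^sub>v r" by simp
  have "Z *\<^sub>v 0\<^sub>v r = 0\<^sub>v n" using Z by (intro eq_vecI) auto
  then have "S *\<^sub>v x = 0\<^sub>v n" using 0 Sx w0 unfolding w_def by simp
  then have "A *\<^sub>v (x - Z *\<^sub>v y) = 0\<^sub>v n"
    using S_mult_vec[OF x] mult_minus_distrib_mat_vec[OF A_carrier x z(1)] unfolding y_def by simp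
  then have "(x - Z *\<^sub>v y) \<bullet> (A *\<^sub>v (x - Z *\<^sub>v y)) = 0" using z by simp
  then have d: "x - Z *\<^sub>v y = 0\<^sub>v n" using A_pos[OF z(2)] by force
  have xy: "x = Z *\<^sub>v y"
  proof (rule eq_vecI)
    fix i assume "i < dim_vec (Z *\<^sub>v y)"
    then show "x $ i = (Z *\<^sub>v y) $ i" using arg_cong[OF d, of "\<lambda>v. v $ i"] x z Z by simp
  qed (use x z Z in auto)
  then have "y = 0\<^sub>v r" using Z_inject[OF y] w0 unfolding w_def by simp
  then show "x = 0\<^sub>v n" using xy \<open>Z *\<^sub>v 0\<^sub>v r = 0\<^sub>v n\<close> by simp
qed

section \<open>Bounds for the nonzero eigenvalues\<close>

lemma eigenvalue_S_form:
  assumes "poly (char_poly S) \<mu> = 0" "\<mu> \<noteq> 0"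
  obtains x where "x \<in> carrier_vec n" "0 < x \<bullet> x" "Z\<^sup>T *\<^sub>v x = 0\<^sub>v r"
    "\<mu> * (x \<bullet> x) = x \<bullet> (A *\<^sub>v x) - (W *\<^sub>v x) \<bullet> (Einv *\<^sub>v (W *\<^sub>v x))"
proof -
  obtain x where x: "x \<in> carrier_vec n" "x \<noteq> 0\<^sub>v n" and ev: "S *\<^sub>v x = \<mu> \<cdot>\<^sub>v x"
    using eigenvalue_root_char_poly[OF S_carrier] assms(1) S_carrier
    unfolding eigenvalue_def eigenvector_def by auto
  have pos: "0 < x \<bullet> x"
    using scalar_prod_self_nonneg[of x] scalar_prod_self_eq_0_iff[OF x(1)] x(2) by linarith
  have y: "Einv *\<^sub>v (W *\<^sub>v x) \<in> carrier_vec r" using Einv(3) W_mult_vec[OF x(1)] by auto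
  have "Z\<^sup>T *\<^sub>v (\<mu> \<cdot>\<^sub>v x) = \<mu> \<cdot>\<^sub>v (Z\<^sup>T *\<^sub>v x)" by (rule mult_mat_vec[of _ r n]) (use Z x in auto)
  \<comment> \<open>As Z^T S = 0, an eigenvector is orthogonal to \<open>Z\<close> once its
    eigenvalue can be cancelled; this is where the eigenvalue 0 is excluded.\<close>
  then have \<mu>0: "\<mu> \<cdot>\<^sub>v (Z\<^sup>T *\<^sub>v x) = 0\<^sub>v r" using Zt_S_mult_vec[OF x(1)] ev by simp
  have Zx: "Z\<^sup>T *\<^sub>v x = 0\<^sub>v r"
  proof (rule eq_vecI)
    fix i assume "i < dim_vec (0\<^sub>v r :: real vec)"
    then show "(Z\<^sup>T *\<^sub>v x) $ i = 0\<^sub>v r $ i"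
      using arg_cong[OF \<mu>0, of "\<lambda>v. v $ i"] assms(2) Z by simp
  qed (use Z in auto)
  have "\<mu> * (x \<bullet> x) = x \<bullet> (S *\<^sub>v x)" unfolding ev using x by simp
  also have "\<dots> = x \<bullet> (A *\<^sub>v x) - x \<bullet> (A *\<^sub>v (Z *\<^sub>v (Einv *\<^sub>v (W *\<^sub>v x))))"
    unfolding S_mult_vec[OF x(1)]
    by (rule scalar_prod_minus_distrib[of _ n]) (use x A_carrier Z_mult_vec[OF y] in auto)
  also have "x \<bullet> (A *\<^sub>v (Z *\<^sub>v (Einv *\<^sub>v (W *\<^sub>v x)))) = (W *\<^sub>v x) \<bullet> (Einv *\<^sub>v (W *\<^sub>v x))"
    using scalar_prod_transpose[of "W\<^sup>T" n r x "Einv *\<^sub>v (W *\<^sub>v x)"] W_carrier x y Wt_mult_vec[OF y] by simp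
  finally show ?thesis using that x(1) pos Zx by blast
qed

lemma S_upper:
  assumes "poly (char_poly S) \<mu> = 0" "\<mu> \<noteq> 0"
  shows "\<mu> \<le> lambda_max Lamp"
proof -
  obtain x where x: "x \<in> carrier_vec n" "0 < x \<bullet> x"
    and \<mu>: "\<mu> * (x \<bullet> x) = x \<bullet> (A *\<^sub>v x) - (W *\<^sub>v x) \<bullet> (Einv *\<^sub>v (W *\<^sub>v x))"
    using eigenvalue_S_form[OF assms] by metis
  have "\<mu> * (x \<bullet> x) \<le> lambda_max Lamp * (x \<bullet> x)"
    unfolding \<mu> using A_upper[OF x(1)] Einv_form_nonneg[OF W_mult_vec(2)[OF x(1)]] by linarith
  then show ?thesis using x(2) by simp
qed

text \<open>With v the i-th column of \<open>V\<close> and w = Z^T v, the i-th entry of V^T Z w is v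
  . Z w = |w|^2. Hence lam_i |w|^4 is one term of a sum bounded by w . E w, thus at most the norm of
  \<open>E\<close> times |w|^2. Dividing by |w|^2 leaves lam_i |w|^2, and |w|^2 is at least 1 -
  dist^2.\<close>

lemma lam_le_norm_E:
  assumes i: "i < r"
  shows "lam i * (1 - (subspace_dist Z V)\<^sup>2) \<le> spectral_norm E"
proof -
  let ?v = "V *\<^sub>v unit_vec r i"
  define w where "w = Z\<^sup>T *\<^sub>v ?v"
  have v: "?v \<in> carrier_vec n" using V by auto
  have w: "w \<in> carrier_vec r" using Z v by (auto simp: w_def)
  note z = Z_mult_vec[OF w]
  have ww: "1 - (subspace_dist Z V)\<^sup>2 \<le> w \<bullet> w"
    using subspace_dist_residual(2)[OF Z ZtZ V VtV, of "unit_vec r i"] i unfolding w_def by simp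
  have E0: "0 \<le> spectral_norm E" by (rule spectral_norm_nonneg[OF E_carrier]) (use r in simp)
  have "lam i * (w \<bullet> w) \<le> spectral_norm E"
  proof (cases "w \<bullet> w = 0")
    case True
    then show ?thesis using E0 by simp
  next
    case False
    have "(V\<^sup>T *\<^sub>v (Z *\<^sub>v w)) $ i = unit_vec r i \<bullet> (V\<^sup>T *\<^sub>v (Z *\<^sub>v w))"
      using i Vt_carrier[OF z] by simp
    also have "\<dots> = ?v \<bullet> (Z *\<^sub>v w)"
      using scalar_prod_transpose[of "V\<^sup>T" r n "unit_vec r i"] V z by simp
    also have "\<dots> = w \<bullet> w" unfolding w_def by (rule scalar_prod_transpose[OF Z v]) (use w w_def in simp)
    finally have "lam i * (w \<bullet> w)\<^sup>2 = lam i * ((V\<^sup>T *\<^sub>v (Z *\<^sub>v w)) $ i)\<^sup>2" by simp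
    also have "\<dots> \<le> (\<Sum>i<r. lam i * ((V\<^sup>T *\<^sub>v (Z *\<^sub>v w)) $ i)\<^sup>2)"
      using i lam_pos r by (intro member_le_sum) (auto intro!: mult_nonneg_nonneg intro: less_imp_le)
    also have "\<dots> \<le> w \<bullet> (E *\<^sub>v w)" unfolding E_form[OF w] by (rule A_lower_V[OF z])
    also have "\<dots> \<le> spectral_norm E * (w \<bullet> w)" by (rule spectral_norm_quadratic_form[OF E_carrier w])
    finally show ?thesis using False scalar_prod_self_nonneg[of w] by (simp add: power2_eq_square)
  qed
  moreover have "lam i * (1 - (subspace_dist Z V)\<^sup>2) \<le> lam i * (w \<bullet> w)"
    using ww lam_pos[of i] i r by (intro mult_left_mono) auto
  ultimately show ?thesis by linarith
qed

text \<open>Here s and c stand for the sine and cosine of the angle. In both halves of the split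
  form a factor s appears: along \<open>V\<close> it comes from x, which is nearly orthogonal to
  \<open>V\<close>, and along \<open>Vp\<close> from z = Z w, which lies nearly in the range of
  \<open>V\<close>.\<close>

lemma W_bound:
  assumes x: "x \<in> carrier_vec n" and Zx: "Z\<^sup>T *\<^sub>v x = 0\<^sub>v r"
    and s: "s = subspace_dist Z V" and c: "0 < c" "c\<^sup>2 = 1 - s\<^sup>2"
  shows "sqrt ((W *\<^sub>v x) \<bullet> (W *\<^sub>v x)) \<le> s / c * (spectral_norm E + lambda_max Lamp) * sqrt (x \<bullet> x)"
proof -
  define w where "w = W *\<^sub>v x"
  have w: "w \<in> carrier_vec r" unfolding w_def by (rule W_mult_vec(2)[OF x])
  define z where "z = Z *\<^sub>v w"
  have z: "z \<in> carrier_vec n" unfolding z_def by (rule Z_mult_vec[OF w])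
  let ?N = "\<lambda>v :: real vec. sqrt (v \<bullet> v)"
  have s0: "0 \<le> s" unfolding s by (rule subspace_dist_nonneg[OF Z V]) (use r in simp)
  have c1: "c \<le> 1" using c(2) by (simp add: power2_le_imp_le[of c 1])
  have E0: "0 \<le> spectral_norm E" by (rule spectral_norm_nonneg[OF E_carrier]) (use r in simp)
  note L0 = lambda_max_pos
  have Vx: "?N (V\<^sup>T *\<^sub>v x) \<le> s * ?N x"
    using subspace_dist_orthogonal_vec[OF Z V VtV x Zx] s0 unfolding s[symmetric]
    by (intro real_le_lsqrt) (auto simp: power_mult_distrib scalar_prod_self_nonneg)
  have Vpx: "?N (Vp\<^sup>T *\<^sub>v x) \<le> ?N x"
    using scalar_prod_split[OF x x] scalar_prod_self_nonneg[of "V\<^sup>T *\<^sub>v x"] by simp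
  have Vpz: "(Vp\<^sup>T *\<^sub>v z) \<bullet> (Vp\<^sup>T *\<^sub>v z) \<le> s\<^sup>2 * (w \<bullet> w)"
    using subspace_dist_residual(1)[OF Z ZtZ V VtV w] scalar_prod_split[OF z z]
      orthonormal_isometry[OF Z ZtZ w w] unfolding z_def s by simp
  have cV: "Lam *\<^sub>v (V\<^sup>T *\<^sub>v z) \<in> carrier_vec r" and cVp: "Lamp *\<^sub>v (Vp\<^sup>T *\<^sub>v z) \<in> carrier_vec (n - r)"
    using mult_mat_vec_carrier[OF mat_diag_dim Vt_carrier[OF z]]
      mult_mat_vec_carrier[OF mat_diag_dim Vpt_carrier[OF z]] by auto
  have LV: "?N (Lam *\<^sub>v (V\<^sup>T *\<^sub>v z)) \<le> spectral_norm E / c * ?N w"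
  proof (rule real_le_lsqrt)
    have "(Lam *\<^sub>v (V\<^sup>T *\<^sub>v z)) \<bullet> (Lam *\<^sub>v (V\<^sup>T *\<^sub>v z)) = (\<Sum>i<r. lam i * (lam i * ((V\<^sup>T *\<^sub>v z) $ i)\<^sup>2))"
      unfolding scalar_prod_self_sum[OF cV]
      by (intro sum.cong) (auto simp: mat_diag_mult_vec[OF Vt_carrier[OF z]] power2_eq_square)
    \<comment> \<open>Only one of the two factors \<open>lam i\<close> is estimated by
      \<open>lam_le_norm_E\<close>. The other one stays, so that the sum is bounded by w . E w,
      which contributes the second power of the norm of \<open>E\<close> without another
      1/c.\<close>
    also have "\<dots> \<le> (\<Sum>i<r. spectral_norm E / c\<^sup>2 * (lam i * ((V\<^sup>T *\<^sub>v z) $ i)\<^sup>2))"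
    proof (intro sum_mono mult_right_mono)
      fix i assume i: "i \<in> {..<r}"
      then show "lam i \<le> spectral_norm E / c\<^sup>2"
        using lam_le_norm_E[of i] c(1) unfolding s[symmetric] c(2)[symmetric] by (simp add: field_simps)
      show "0 \<le> lam i * ((V\<^sup>T *\<^sub>v z) $ i)\<^sup>2" using i r lam_pos[of i] by simp
    qed
    also have "\<dots> = spectral_norm E / c\<^sup>2 * (\<Sum>i<r. lam i * ((V\<^sup>T *\<^sub>v z) $ i)\<^sup>2)"
      by (rule sum_distrib_left[symmetric])
    also have "\<dots> \<le> spectral_norm E / c\<^sup>2 * (spectral_norm E * (w \<bullet> w))"
      using A_lower_V[OF z] spectral_norm_quadratic_form[OF E_carrier w] E_form[OF w] E0
      unfolding z_def by (intro mult_left_mono) auto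
    also have "\<dots> = (spectral_norm E / c * ?N w)\<^sup>2"
      by (simp add: power_mult_distrib power_divide scalar_prod_self_nonneg power2_eq_square[of "spectral_norm E"])
    finally show "(Lam *\<^sub>v (V\<^sup>T *\<^sub>v z)) \<bullet> (Lam *\<^sub>v (V\<^sup>T *\<^sub>v z)) \<le> (spectral_norm E / c * ?N w)\<^sup>2" .
  qed (use E0 c in \<open>auto simp: scalar_prod_self_nonneg\<close>)
  have LVp: "?N (Lamp *\<^sub>v (Vp\<^sup>T *\<^sub>v z)) \<le> lambda_max Lamp * s * ?N w"
  proof (rule real_le_lsqrt)
    have "(Lamp *\<^sub>v (Vp\<^sup>T *\<^sub>v z)) \<bullet> (Lamp *\<^sub>v (Vp\<^sup>T *\<^sub>v z)) = (\<Sum>i<n - r. (lam (r + i))\<^sup>2 * ((Vp\<^sup>T *\<^sub>v z) $ i)\<^sup>2)"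
      unfolding scalar_prod_self_sum[OF cVp]
      by (intro sum.cong) (auto simp: mat_diag_mult_vec[OF Vpt_carrier[OF z]] power_mult_distrib)
    also have "\<dots> \<le> (\<Sum>i<n - r. (lambda_max Lamp)\<^sup>2 * ((Vp\<^sup>T *\<^sub>v z) $ i)\<^sup>2)"
      using lam_le_max lam_pos by (intro sum_mono mult_right_mono power_mono) (auto intro: less_imp_le)
    also have "\<dots> = (lambda_max Lamp)\<^sup>2 * ((Vp\<^sup>T *\<^sub>v z) \<bullet> (Vp\<^sup>T *\<^sub>v z))"
      unfolding scalar_prod_self_sum[OF Vpt_carrier[OF z]] by (rule sum_distrib_left[symmetric])
    also have "\<dots> \<le> (lambda_max Lamp)\<^sup>2 * (s\<^sup>2 * (w \<bullet> w))" by (rule mult_left_mono[OF Vpz]) simp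
    also have "\<dots> = (lambda_max Lamp * s * ?N w)\<^sup>2"
      by (simp add: power_mult_distrib scalar_prod_self_nonneg)
    finally show "(Lamp *\<^sub>v (Vp\<^sup>T *\<^sub>v z)) \<bullet> (Lamp *\<^sub>v (Vp\<^sup>T *\<^sub>v z)) \<le> (lambda_max Lamp * s * ?N w)\<^sup>2" .
  qed (use L0 s0 in \<open>auto simp: scalar_prod_self_nonneg\<close>)
  have "?N w * ?N w = w \<bullet> w" by (simp add: scalar_prod_self_nonneg)
  also have "\<dots> = x \<bullet> (A *\<^sub>v z)"
    using scalar_prod_transpose[of "W\<^sup>T" n r x w] W_carrier x w Wt_mult_vec[OF w]
    unfolding z_def by (simp flip: w_def)
  also have "\<dots> \<le> ?N (V\<^sup>T *\<^sub>v x) * ?N (Lam *\<^sub>v (V\<^sup>T *\<^sub>v z)) + ?N (Vp\<^sup>T *\<^sub>v x) * ?N (Lamp *\<^sub>v (Vp\<^sup>T *\<^sub>v z))"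
    unfolding A_form[OF x z]
    by (intro add_mono scalar_prod_le_norms) (rule Vt_carrier[OF x] Vpt_carrier[OF x] cV cVp)+
  also have "\<dots> \<le> (s * ?N x) * (spectral_norm E / c * ?N w) + ?N x * (lambda_max Lamp * s * ?N w)"
    using Vx Vpx LV LVp s0 by (intro add_mono mult_mono) (auto simp: scalar_prod_self_nonneg)
  \<comment> \<open>The factor s is weakened to s/c, as c is at most 1, so that tan theta can be
    taken out of both terms.\<close>
  also have "?N x * (lambda_max Lamp * s * ?N w) \<le> ?N x * (lambda_max Lamp * (s / c) * ?N w)"
    using c c1 s0 L0
    by (intro mult_left_mono mult_right_mono) (auto simp: scalar_prod_self_nonneg pos_le_divide_eq mult_left_le)
  also have "(s * ?N x) * (spectral_norm E / c * ?N w) + ?N x * (lambda_max Lamp * (s / c) * ?N w)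
    = (s / c * (spectral_norm E + lambda_max Lamp) * ?N x) * ?N w" using c by (simp add: field_simps)
  finally have *: "?N w * ?N w \<le> (s / c * (spectral_norm E + lambda_max Lamp) * ?N x) * ?N w" by simp
  show ?thesis
  proof (cases "?N w = 0")
    case True
    then show ?thesis using s0 c E0 L0 unfolding w_def[symmetric] True by (simp add: scalar_prod_self_nonneg)
  next
    case False
    then have "0 < ?N w" using scalar_prod_self_nonneg[of w] by simp
    then show ?thesis using * unfolding w_def[symmetric] by (simp only: mult_le_cancel_right_pos)
  qed
qed

text \<open>In the Rayleigh quotient of \<open>eigenvalue_S_form\<close>, the term with
  \<open>A\<close> is at least lambda_min times |Vp^T x|^2, and orthogonality to \<open>Z\<close>
  leaves at least (1 - s^2) |x|^2 there. The subtracted term is at most the norm of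
  \<open>Einv\<close> times the square of \<open>W_bound\<close>.\<close>

lemma S_lower:
  assumes "poly (char_poly S) \<mu> = 0" "\<mu> \<noteq> 0"
    and s: "s = subspace_dist Z V" and c: "0 < c" "c\<^sup>2 = 1 - s\<^sup>2"
  shows "lambda_min Lamp - (lambda_max Lamp * s\<^sup>2 +
      spectral_norm Einv * (spectral_norm E + lambda_max Lamp)\<^sup>2 * (s / c)\<^sup>2) \<le> \<mu>"
proof -
  obtain x where x: "x \<in> carrier_vec n" "0 < x \<bullet> x" and Zx: "Z\<^sup>T *\<^sub>v x = 0\<^sub>v r"
    and \<mu>: "\<mu> * (x \<bullet> x) = x \<bullet> (A *\<^sub>v x) - (W *\<^sub>v x) \<bullet> (Einv *\<^sub>v (W *\<^sub>v x))"
    using eigenvalue_S_form[OF assms(1,2)] by metis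
  let ?K = "s / c * (spectral_norm E + lambda_max Lamp)"
  have Ei0: "0 \<le> spectral_norm Einv" by (rule spectral_norm_nonneg[OF Einv(3)]) (use r in simp)
  have "(W *\<^sub>v x) \<bullet> (W *\<^sub>v x) \<le> ?K\<^sup>2 * (x \<bullet> x)"
    using power_mono[OF W_bound[OF x(1) Zx s c], of 2]
    unfolding power_mult_distrib[of ?K] by (simp add: scalar_prod_self_nonneg)
  then have 1: "(W *\<^sub>v x) \<bullet> (Einv *\<^sub>v (W *\<^sub>v x)) \<le> spectral_norm Einv * (?K\<^sup>2 * (x \<bullet> x))"
    using spectral_norm_quadratic_form[OF Einv(3) W_mult_vec(2)[OF x(1)]] Ei0
    by (meson mult_left_mono order_trans)
  \<comment> \<open>The loss lambda_min s^2 is replaced by the larger lambda_max s^2, which is the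
    form in which it enters epsilon_D.\<close>
  have m: "lambda_min Lamp * s\<^sup>2 \<le> lambda_max Lamp * s\<^sup>2"
    using lambda_min_le_max by (intro mult_right_mono) auto
  have min0: "0 \<le> lambda_min Lamp" using lambda_min_pos by simp
  have "(1 - s\<^sup>2) * (x \<bullet> x) \<le> (Vp\<^sup>T *\<^sub>v x) \<bullet> (Vp\<^sup>T *\<^sub>v x)"
    using subspace_dist_orthogonal_vec[OF Z V VtV x(1) Zx] scalar_prod_split[OF x(1) x(1)]
    unfolding s by (simp add: algebra_simps)
  then have "lambda_min Lamp * ((1 - s\<^sup>2) * (x \<bullet> x)) \<le> x \<bullet> (A *\<^sub>v x)"
    using A_lower_Vp[OF x(1)] min0 by (meson mult_left_mono order_trans)
  with 1 have "(lambda_min Lamp * (1 - s\<^sup>2) - spectral_norm Einv * ?K\<^sup>2) * (x \<bullet> x) \<le> \<mu> * (x \<bullet> x)"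
    unfolding \<mu> by (simp add: algebra_simps)
  then have "lambda_min Lamp * (1 - s\<^sup>2) - spectral_norm Einv * ?K\<^sup>2 \<le> \<mu>" using x(2) by simp
  then show ?thesis using m unfolding right_diff_distrib power_mult_distrib by (simp add: mult_ac)
qed

end

section \<open>Counting the eigenvalues and translating the bounds into the angle\<close>

theorem theorem3p3:
  fixes n r :: nat
    and A V Vp Lam Lamp Z E Einv PD :: "real mat"
    and lam :: "nat \<Rightarrow> real"
    and \<theta> \<eta>D \<epsilon>D :: real
  assumes r: "1 \<le> r" "r < n"
    and A: "sym_pos_def n A"
    and V: "V \<in> carrier_mat n r"
    and Vp: "Vp \<in> carrier_mat n (n - r)"
    and orth: "orthonormal_cols (hconcat V Vp)"
    and Lam: "Lam = mat_diag r lam"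
    and Lamp: "Lamp = mat_diag (n - r) (\<lambda>i. lam (r + i))"
    and decomp: "A = V * Lam * V\<^sup>T + Vp * Lamp * Vp\<^sup>T"
    and ordered: "\<forall>i<r. \<forall>j\<in>{r..<n}. lam i \<le> lam j"
    and Z: "Z \<in> carrier_mat n r" "orthonormal_cols Z"
    and E: "E = Z\<^sup>T * A * Z"
    and Einv: "Einv = the (mat_inverse E)"
    and PD: "PD = 1\<^sub>m n - A * Z * Einv * Z\<^sup>T"
    and \<theta>: "\<theta> = acute_angle Z V"
    and \<eta>D: "\<eta>D = lambda_max Lamp * (sin \<theta> + (sin \<theta>)\<^sup>2)"
    and \<epsilon>D: "\<epsilon>D = \<eta>D + spectral_norm Einv * (spectral_norm E + lambda_max Lamp)\<^sup>2 * (tan \<theta>)\<^sup>2"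
  shows "count (eigenvalues_mset (PD * A)) 0 = r \<and>
    size {#\<mu> \<in># eigenvalues_mset (PD * A). \<mu> \<noteq> 0#} = n - r \<and>
    (cos \<theta> \<noteq> 0 \<longrightarrow>
      (\<forall>\<mu> \<in># eigenvalues_mset (PD * A). \<mu> \<noteq> 0 \<longrightarrow>
         lambda_min Lamp - \<epsilon>D \<le> \<mu> \<and> \<mu> \<le> lambda_max Lamp + \<eta>D))"
proof -
  note defs = E Einv PD
  interpret deflation n r V Vp A lam Z
    using r A V Vp orth decomp ordered Z unfolding Lam Lamp
    by unfold_locales (auto simp: orthonormal_cols_def)
  \<comment> \<open>\<open>E\<close> and \<open>Einv\<close> now denote the variables of the
    statement; they are identified with the constants of the locale in order to use its
    lemmas.\<close>
  have E': "E = deflation.E A Z" unfolding defs(1) E_def ..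
  have Einv': "Einv = deflation.Einv A Z" unfolding defs(2) E' Einv_def ..
  have S': "PD * A = S" unfolding defs(3) Einv' S_def ..
  have nz: "char_poly S \<noteq> 0" using degree_monic_char_poly[OF S_carrier] by auto
  have count: "count (eigenvalues_mset S) 0 = r"
    unfolding eigenvalues_mset_def using order_0_S nz by simp
  have "size {#\<mu> \<in># eigenvalues_mset S. \<mu> \<noteq> 0#} + size {#\<mu> \<in># eigenvalues_mset S. \<mu> = 0#}
      = size (eigenvalues_mset S)"
    using arg_cong[OF multiset_partition[of "eigenvalues_mset S" "\<lambda>\<mu>. \<mu> \<noteq> 0"], of size]
    unfolding size_union not_not by (rule sym)
  then have size: "size {#\<mu> \<in># eigenvalues_mset S. \<mu> \<noteq> 0#} = n - r"
    using size_eigenvalues_mset_symmetric[OF S_carrier S_sym] count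
    by (simp add: filter_eq_replicate_mset)
  define s where "s = subspace_dist Z V"
  \<comment> \<open>The distance has to lie in the domain of \<open>arcsin\<close>, so that sin
    theta is the distance itself.\<close>
  have s: "0 \<le> s" "s \<le> 1"
    unfolding s_def using subspace_dist_nonneg[OF Z(1) V] subspace_dist_le_1[OF Z(1) ZtZ V VtV] r by auto
  have sin: "sin \<theta> = s" unfolding \<theta> acute_angle_def s_def[symmetric] using s by simp
  have bounds: "lambda_min Lamp - \<epsilon>D \<le> \<mu> \<and> \<mu> \<le> lambda_max Lamp + \<eta>D"
    if cos: "cos \<theta> \<noteq> 0" and \<mu>: "poly (char_poly S) \<mu> = 0" "\<mu> \<noteq> 0" for \<mu>
  proof -
    \<comment> \<open>The values of \<open>arcsin\<close> lie between -pi/2 and pi/2, so the cosine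
      is nonnegative; being nonzero, it can serve as the constant c of
      \<open>S_lower\<close>.\<close>
    have "cos \<theta> \<ge> 0" unfolding \<theta> acute_angle_def s_def[symmetric]
      using s arcsin_bounded[of s] by (intro cos_ge_zero) auto
    then have c: "0 < cos \<theta>" "(cos \<theta>)\<^sup>2 = 1 - s\<^sup>2" using cos cos_squared_eq[of \<theta>] sin by auto
    \<comment> \<open>Both terms of eta_D are nonnegative, so they may be added to the bound of
      \<open>S_upper\<close>, and the term linear in sin theta may be added to the loss in
      \<open>S_lower\<close>.\<close>
    have "lambda_max Lamp * s \<ge> 0" "lambda_max Lamp * s\<^sup>2 \<ge> 0" using lambda_max_pos s unfolding Lamp by auto
    then show ?thesis
      using S_upper[OF \<mu>] S_lower[OF \<mu> s_def c]
      unfolding \<epsilon>D \<eta>D sin tan_def E' Einv' Lamp by (simp add: distrib_left)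
  qed
  show ?thesis
    unfolding S' using count size bounds nz by (auto simp: eigenvalues_mset_def)
qed

end
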